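(* Let $N$ be a finite set and $f: 2^{N} \to \mathbb{R} \cup \{-\infty\}$ with $\mathrm{dom}\, f \neq \emptyset$. Then $f$ is M$^\natural$-concave if and only if $f$ satisfies the multiple exchange property: for all $X, Y \subseteq N$ and $I \subseteq X \setminus Y$ there exists $J \subseteq Y \setminus X$ with $f(X)+f(Y) \le f((X\setminus I)\cup J) + f((Y \setminus J)\cup I)$.
   Context: For $f: 2^N \to \mathbb{R}\cup\{-\infty\}$, $\mathrm{dom}\, f = \{X \subseteq N : f(X) > -\infty\}$. Notation: $X - i = X \setminus \{i\}$, $Y + i = Y \cup \{i\}$, $X - i + j = (X\setminus\{i\})\cup\{j\}$, $Y + i - j = (Y \cup\{i\})\setminus\{j\}$. Conventions: $(-\infty)+a = a+(-\infty) = (-\infty)+(-\infty) = -\infty$ for $a \in \mathbb{R}$, $-\infty \le -\infty$, and a maximum over an empty set is $-\infty$. A function $f: 2^N \to \mathbb{R}\cup\{-\infty\}$ with $\mathrm{dom}\, f \neq \emptyset$ is M$^\natural$-concave if for all $X, Y \subseteq N$ and $i \in X \setminus Y$: $$f(X)+f(Y) \le \max\Big[ f(X-i)+f(Y+i),\ \max_{j \in Y\setminus X}\{ f(X-i+j)+f(Y+i-j)\}\Big].$$ *)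

theory Defs
  imports "HOL-Library.Extended_Real"
begin

text \<open>Functions f : 2^N -> R \<union> {-\<infinity>} are modelled as f :: 'a set => ereal with f X \<noteq> \<infinity>
  for X \<subseteq> N; only values on subsets of N matter.\<close>

definition dom_f :: "'a set \<Rightarrow> ('a set \<Rightarrow> ereal) \<Rightarrow> 'a set set" where
  "dom_f N f = {X. X \<subseteq> N \<and> f X > -\<infinity>}"

definition valuated_on :: "'a set \<Rightarrow> ('a set \<Rightarrow> ereal) \<Rightarrow> bool" where
  "valuated_on N f \<longleftrightarrow> (\<forall>X\<subseteq>N. f X \<noteq> \<infinity>) \<and> dom_f N f \<noteq> {}"

definition M_nat_concave :: "'a set \<Rightarrow> ('a set \<Rightarrow> ereal) \<Rightarrow> bool" where
  "M_nat_concave N f \<longleftrightarrow> valuated_on N f \<and>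
     (\<forall>X Y i. X \<subseteq> N \<longrightarrow> Y \<subseteq> N \<longrightarrow> i \<in> X - Y \<longrightarrow>
        f X + f Y \<le> max (f (X - {i}) + f (insert i Y))
          (Sup ((\<lambda>j. f (insert j (X - {i})) + f (insert i Y - {j})) ` (Y - X))))"

definition multiple_exchange :: "'a set \<Rightarrow> ('a set \<Rightarrow> ereal) \<Rightarrow> bool" where
  "multiple_exchange N f \<longleftrightarrow>
     (\<forall>X Y I. X \<subseteq> N \<longrightarrow> Y \<subseteq> N \<longrightarrow> I \<subseteq> X - Y \<longrightarrow>
        (\<exists>J. J \<subseteq> Y - X \<and> f X + f Y \<le> f ((X - I) \<union> J) + f ((Y - J) \<union> I)))"

end

theory Submission
  imports Defs
begin

text \<open>
  From exchange to multiple exchange: fix \<open>X\<close>, \<open>Y\<close>, \<open>I\<close> and put \<open>E = Y - X\<close>. One looks for a partition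
  of \<open>E\<close> into \<open>J\<close> and \<open>E - J\<close> that maximizes the sum of the two M-natural-concave functions
  \<open>J \<mapsto> f ((X - I) \<union> J)\<close> and \<open>K \<mapsto> f ((X \<inter> Y) \<union> I \<union> K)\<close>. A primal-dual method in the style of Frank's
  weight splitting reaches the value \<open>f X + f Y\<close> provided that, for all prices \<open>p\<close> on \<open>E\<close>, the two
  maxima of the functions with \<open>p\<close> added sum up to at least \<open>f X + f Y + p(E)\<close>. This bound holds
  because maximizing \<open>f + p\<close> over the intersection with \<open>E\<close> yields a submodular function of the
  intersection with \<open>X - Y\<close>.

  From multiple exchange to exchange: in a counterexample with \<open>card (X - Y) + card (Y - X)\<close> minimal,
  one replaces \<open>Y\<close> by the best set next to it in the direction of \<open>X\<close>, with respect to prices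
  witnessing the failure; local exchange properties show that the failure persists. For the induction to
  work, a pure removal of \<open>i\<close> must be forbidden unless \<open>card (Y - X) < card (X - Y)\<close>.
\<close>

section \<open>Exchange on the effective domain\<close>

text \<open>The option \<open>None\<close> plays the role of a dummy element, so that \<open>swap\<close> covers removals and additions.\<close>

definition swap :: "'a set \<Rightarrow> 'a option \<Rightarrow> 'a option \<Rightarrow> 'a set" where
  "swap S x y = S - set_option x \<union> set_option y"

text \<open>Requiring both exchanged sets to lie in \<open>D\<close> replaces the value minus
  infinity, so every inequality is between reals.\<close>

definition mnat :: "'a set set \<Rightarrow> ('a set \<Rightarrow> real) \<Rightarrow> bool" where
  "mnat D g \<longleftrightarrow> (\<forall>X\<in>D. \<forall>Y\<in>D. \<forall>i\<in>X - Y. \<exists>e. set_option e \<subseteq> Y - X \<and>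
     swap X (Some i) e \<in> D \<and> swap Y e (Some i) \<in> D \<and>
     g X + g Y \<le> g (swap X (Some i) e) + g (swap Y e (Some i)))"

definition mexch :: "'a set set \<Rightarrow> ('a set \<Rightarrow> real) \<Rightarrow> bool" where
  "mexch D g \<longleftrightarrow> (\<forall>X\<in>D. \<forall>Y\<in>D. \<forall>I\<subseteq>X - Y. \<exists>J\<subseteq>Y - X.
     (X - I) \<union> J \<in> D \<and> (Y - J) \<union> I \<in> D \<and> g X + g Y \<le> g ((X - I) \<union> J) + g ((Y - J) \<union> I))"

lemma ex_max_on_finite:
  fixes h :: "'b \<Rightarrow> real"
  assumes "finite S" "S \<noteq> {}"
  obtains m where "m \<in> S" "\<And>x. x \<in> S \<Longrightarrow> h x \<le> h m"
proof -
  have "Max (h ` S) \<in> h ` S" using assms by simp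
  then obtain m where "m \<in> S" "Max (h ` S) = h m" by auto
  then show ?thesis using that assms by (metis Max_ge finite_imageI imageI)
qed

lemma mnatD:
  assumes "mnat D g" "X \<in> D" "Y \<in> D" "i \<in> X - Y"
  obtains e where "set_option e \<subseteq> Y - X" "swap X (Some i) e \<in> D" "swap Y e (Some i) \<in> D"
    "g X + g Y \<le> g (swap X (Some i) e) + g (swap Y e (Some i))"
  using assms unfolding mnat_def by blast

section \<open>Multiple exchange implies exchange\<close>

lemma mexchD:
  assumes "mexch D g" "X \<in> D" "Y \<in> D" "i \<in> X - Y"
  obtains J where "J \<subseteq> Y - X" "(X - {i}) \<union> J \<in> D" "insert i (Y - J) \<in> D"
    "g X + g Y \<le> g ((X - {i}) \<union> J) + g (insert i (Y - J))"
proof -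
  have "{i} \<subseteq> X - Y" using assms(4) by simp
  then obtain J where "J \<subseteq> Y - X" "(X - {i}) \<union> J \<in> D" "(Y - J) \<union> {i} \<in> D"
    "g X + g Y \<le> g ((X - {i}) \<union> J) + g ((Y - J) \<union> {i})"
    using assms unfolding mexch_def by meson
  then show ?thesis using that by simp
qed

section \<open>Local exchange between sets that are at most two swaps apart\<close>

lemma mexch_submodular:
  assumes "mexch D g" "Z \<in> D" "insert i (insert k Z) \<in> D" "i \<noteq> k" "i \<notin> Z" "k \<notin> Z"
  shows "insert i Z \<in> D" "insert k Z \<in> D"
    "g Z + g (insert i (insert k Z)) \<le> g (insert i Z) + g (insert k Z)"
proof -
  have "i \<in> insert i (insert k Z) - Z" using assms by simp
  from mexchD[OF assms(1,3,2) this] obtain J where J: "J \<subseteq> Z - insert i (insert k Z)"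
    "(insert i (insert k Z) - {i}) \<union> J \<in> D" "insert i (Z - J) \<in> D"
    "g (insert i (insert k Z)) + g Z \<le> g ((insert i (insert k Z) - {i}) \<union> J) + g (insert i (Z - J))"
    by blast
  have "J = {}" using J(1) by blast
  moreover have "insert i (insert k Z) - {i} = insert k Z" using assms by auto
  ultimately show "insert i Z \<in> D" "insert k Z \<in> D"
    "g Z + g (insert i (insert k Z)) \<le> g (insert i Z) + g (insert k Z)" using J by auto
qed

text \<open>When \<open>a\<close> leaves the larger set, \<open>i\<close> is the only possible
  partner. The two alternatives are the exchange without a partner and the one with
  \<open>i\<close>.\<close>

lemma mexch_exchange_12:
  assumes "mexch D g" "insert i Z \<in> D" "insert a (insert b Z) \<in> D"
    "i \<notin> Z" "a \<notin> Z" "b \<notin> Z" "i \<noteq> a" "i \<noteq> b" "a \<noteq> b"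
  shows "(insert i (insert a Z) \<in> D \<and> insert b Z \<in> D \<and>
      g (insert i Z) + g (insert a (insert b Z)) \<le> g (insert i (insert a Z)) + g (insert b Z)) \<or>
    (insert i (insert b Z) \<in> D \<and> insert a Z \<in> D \<and>
      g (insert i Z) + g (insert a (insert b Z)) \<le> g (insert i (insert b Z)) + g (insert a Z))"
proof -
  have "a \<in> insert a (insert b Z) - insert i Z" using assms by simp
  from mexchD[OF assms(1,3,2) this] obtain J where J: "J \<subseteq> insert i Z - insert a (insert b Z)"
    "(insert a (insert b Z) - {a}) \<union> J \<in> D" "insert a (insert i Z - J) \<in> D"
    "g (insert a (insert b Z)) + g (insert i Z) \<le>
      g ((insert a (insert b Z) - {a}) \<union> J) + g (insert a (insert i Z - J))" by blast
  have e: "insert a (insert b Z) - {a} = insert b Z" using assms by auto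
  have "J \<subseteq> {i}" using J(1) by blast
  then consider "J = {}" | "J = {i}" by blast
  then show ?thesis
  proof cases
    case 1
    then show ?thesis using J e by (simp add: insert_commute add.commute)
  next
    case 2
    have "insert i Z - {i} = Z" using assms by auto
    then show ?thesis using J 2 e by (simp add: insert_commute add.commute)
  qed
qed

lemma mexch_exchange_21:
  assumes "mexch D g" "insert a Z \<in> D" "insert i (insert k Z) \<in> D"
    "i \<notin> Z" "a \<notin> Z" "k \<notin> Z" "i \<noteq> a" "i \<noteq> k" "a \<noteq> k"
  shows "(insert k Z \<in> D \<and> insert i (insert a Z) \<in> D \<and>
      g (insert a Z) + g (insert i (insert k Z)) \<le> g (insert k Z) + g (insert i (insert a Z))) \<or>
    (insert k (insert a Z) \<in> D \<and> insert i Z \<in> D \<and>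
      g (insert a Z) + g (insert i (insert k Z)) \<le> g (insert k (insert a Z)) + g (insert i Z))"
  using mexch_exchange_12[of D g a Z i k] assms by (auto simp: insert_commute add.commute)

text \<open>Two unbalanced exchanges yield a balanced one: adding the inequalities \<open>u\<close>
  and \<open>a\<close>, submodularity over \<open>insert w Z\<close> and over
  \<open>insert b Z\<close> bounds their right-hand sides by those of the goal plus one copy of the
  original pair, which cancels.\<close>

lemma mexch_uncross:
  assumes "mexch D g" "u \<notin> Z" "w \<notin> Z" "a \<notin> Z" "b \<notin> Z" "distinct [u, w, a, b]"
    and P: "\<And>S T. P S T \<longleftrightarrow> S \<in> D \<and> T \<in> D \<and>
      g (insert u (insert w Z)) + g (insert a (insert b Z)) \<le> g S + g T"
    and D: "insert u (insert w Z) \<in> D" "insert a (insert b Z) \<in> D"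
    and u: "P (insert w Z) (insert u (insert a (insert b Z)))"
    and a: "P (insert b Z) (insert a (insert u (insert w Z)))"
  shows "P (insert w (insert a Z)) (insert u (insert b Z))"
proof -
  have 1: "insert a (insert w Z) \<in> D" "g (insert w Z) + g (insert a (insert u (insert w Z))) \<le>
      g (insert a (insert w Z)) + g (insert u (insert w Z))"
    using mexch_submodular[of D g "insert w Z" a u] assms(1-6) u a unfolding P by auto
  have 2: "insert u (insert b Z) \<in> D" "g (insert b Z) + g (insert u (insert a (insert b Z))) \<le>
      g (insert u (insert b Z)) + g (insert a (insert b Z))"
    using mexch_submodular[of D g "insert b Z" u a] assms(1-6) u a unfolding P by auto
  have "insert a (insert w Z) = insert w (insert a Z)" by auto
  with 1 2 u a show ?thesis unfolding P by simp
qed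

text \<open>Exchanging \<open>i\<close> from the first set may send back none or both of
  \<open>a\<close>, \<open>b\<close>, which is unbalanced; likewise for \<open>a\<close> from the
  second set. If neither exchange is balanced, the two outcomes are uncrossed.\<close>

lemma mexch_exchange_22:
  assumes "mexch D g" "insert i (insert k Z) \<in> D" "insert a (insert b Z) \<in> D"
    and "i \<notin> Z" "k \<notin> Z" "a \<notin> Z" "b \<notin> Z" "distinct [i, k, a, b]"
  shows "(insert i (insert a Z) \<in> D \<and> insert k (insert b Z) \<in> D \<and>
      g (insert i (insert k Z)) + g (insert a (insert b Z)) \<le>
      g (insert i (insert a Z)) + g (insert k (insert b Z))) \<or>
    (insert i (insert b Z) \<in> D \<and> insert k (insert a Z) \<in> D \<and>
      g (insert i (insert k Z)) + g (insert a (insert b Z)) \<le>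
      g (insert i (insert b Z)) + g (insert k (insert a Z)))"
proof -
  define P where "P S T \<longleftrightarrow> S \<in> D \<and> T \<in> D \<and>
    g (insert i (insert k Z)) + g (insert a (insert b Z)) \<le> g S + g T" for S T
  have sym: "P S T \<Longrightarrow> P T S" for S T by (auto simp: P_def)
  let ?T = "P (insert i (insert a Z)) (insert k (insert b Z)) \<or>
    P (insert i (insert b Z)) (insert k (insert a Z))"
  have one: "?T \<or> P (insert k Z) (insert i (insert a (insert b Z)))
      \<or> P (insert i Z) (insert k (insert a (insert b Z)))"
  proof -
    let ?X = "insert i (insert k Z)" and ?Y = "insert a (insert b Z)"
    have "i \<in> ?X - ?Y" using assms by simp
    from mexchD[OF assms(1-3) this] obtain J where J: "J \<subseteq> ?Y - ?X"
      "P (?X - {i} \<union> J) (insert i (?Y - J))" unfolding P_def by blast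
    have "J \<subseteq> {a,b}" using J(1) by blast
    then consider "J = {}" | "J = {a}" | "J = {b}" | "J = {a,b}" by blast
    then show ?thesis
    proof cases
      case 1
      then have "?X - {i} \<union> J = insert k Z" "insert i (?Y - J) = insert i ?Y"
        using assms(4-) by auto
      with J(2) show ?thesis by simp
    next
      case 2
      then have "?X - {i} \<union> J = insert k (insert a Z)" "insert i (?Y - J) = insert i (insert b Z)"
        using assms(4-) by auto
      with J(2) sym show ?thesis by simp
    next
      case 3
      then have "?X - {i} \<union> J = insert k (insert b Z)" "insert i (?Y - J) = insert i (insert a Z)"
        using assms(4-) by auto
      with J(2) sym show ?thesis by simp
    next
      case 4
      then have "?X - {i} \<union> J = insert k ?Y" "insert i (?Y - J) = insert i Z"
        using assms(4-) by auto
      with J(2) sym show ?thesis by simp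
    qed
  qed
  have two: "?T \<or> P (insert b Z) (insert a (insert i (insert k Z)))
      \<or> P (insert a Z) (insert b (insert i (insert k Z)))"
  proof -
    let ?X = "insert i (insert k Z)" and ?Y = "insert a (insert b Z)"
    have "a \<in> ?Y - ?X" using assms by simp
    from mexchD[OF assms(1,3,2) this] obtain J where J: "J \<subseteq> ?X - ?Y"
      "P (?Y - {a} \<union> J) (insert a (?X - J))" unfolding P_def by (metis add.commute)
    have "J \<subseteq> {i,k}" using J(1) by blast
    then consider "J = {}" | "J = {i}" | "J = {k}" | "J = {i,k}" by blast
    then show ?thesis
    proof cases
      case 1
      then have "?Y - {a} \<union> J = insert b Z" "insert a (?X - J) = insert a ?X"
        using assms(4-) by auto
      with J(2) show ?thesis by simp
    next
      case 2
      then have "?Y - {a} \<union> J = insert i (insert b Z)" "insert a (?X - J) = insert k (insert a Z)"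
        using assms(4-) by auto
      with J(2) show ?thesis by simp
    next
      case 3
      then have "?Y - {a} \<union> J = insert k (insert b Z)" "insert a (?X - J) = insert i (insert a Z)"
        using assms(4-) by auto
      with J(2) sym show ?thesis by simp
    next
      case 4
      then have "?Y - {a} \<union> J = insert b ?X" "insert a (?X - J) = insert a Z"
        using assms(4-) by auto
      with J(2) sym show ?thesis by simp
    qed
  qed
  have c: "insert k (insert i Z) = insert i (insert k Z)"
    "insert b (insert a Z) = insert a (insert b Z)" by auto
  \<comment> \<open>Each of the two exchanges has two unbalanced outcomes; \<open>(u, w)\<close> and
    \<open>(d, d')\<close> encode the four combinations in one statement.\<close>
  have unc: "P (insert w (insert d Z)) (insert u (insert d' Z))"
    if "P (insert w Z) (insert u (insert a (insert b Z)))"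
      "P (insert d' Z) (insert d (insert i (insert k Z)))"
      "(u, w) = (i, k) \<or> (u, w) = (k, i)" "(d, d') = (a, b) \<or> (d, d') = (b, a)" for u w d d'
  proof -
    have e: "insert u (insert w Z) = insert i (insert k Z)"
      "insert d (insert d' Z) = insert a (insert b Z)" using that(3,4) c by auto
    show ?thesis
    proof (rule mexch_uncross[OF assms(1), where P = P])
      show "u \<notin> Z" "w \<notin> Z" "d \<notin> Z" "d' \<notin> Z" "distinct [u, w, d, d']"
        using that(3,4) assms(4-8) by auto
      show "P S T \<longleftrightarrow> S \<in> D \<and> T \<in> D \<and>
        g (insert u (insert w Z)) + g (insert d (insert d' Z)) \<le> g S + g T" for S T
        unfolding e P_def ..
    qed (use that(1,2) assms(2,3) in \<open>simp_all only: e\<close>)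
  qed
  have "?T"
    using one two unc[of k i a b] unc[of k i b a] unc[of i k a b] unc[of i k b a] sym by blast
  then show ?thesis unfolding P_def .
qed

text \<open>The common form of the three local exchanges: \<open>None\<close> as a dummy element
  turns all of them into the rule that two swaps at \<open>Y\<close> can be carried out separately,
  possibly with the removed elements \<open>d\<close> and \<open>e\<close> interchanged.\<close>

lemma mexch_local:
  assumes "mexch D g" "Y \<in> D" "swap (swap Y d k) e (Some i) \<in> D"
    and "set_option d \<subseteq> Y" "set_option e \<subseteq> Y" "set_option k \<inter> Y = {}" "i \<notin> Y" "k \<noteq> Some i"
    and "d = e \<Longrightarrow> d = None" "k = None \<Longrightarrow> d \<noteq> None \<and> e \<noteq> None"
  shows "(swap Y d k \<in> D \<and> swap Y e (Some i) \<in> D \<and>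
      g Y + g (swap (swap Y d k) e (Some i)) \<le> g (swap Y d k) + g (swap Y e (Some i))) \<or>
    (swap Y e k \<in> D \<and> swap Y d (Some i) \<in> D \<and>
      g Y + g (swap (swap Y d k) e (Some i)) \<le> g (swap Y e k) + g (swap Y d (Some i)))"
proof (cases k)
  case None
  then obtain a b where ab: "d = Some a" "e = Some b" using assms(10) by auto
  then have ne: "a \<noteq> b" "a \<in> Y" "b \<in> Y" using assms(4,5,9) by auto
  define Z where "Z = Y - {a, b}"
  have eq: "Y = insert a (insert b Z)" "swap (swap Y d k) e (Some i) = insert i Z"
    "swap Y d k = insert b Z" "swap Y e k = insert a Z"
    "swap Y e (Some i) = insert i (insert a Z)" "swap Y d (Some i) = insert i (insert b Z)"
    using ne ab None by (auto simp: swap_def Z_def)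
  have notin: "i \<notin> Z" "a \<notin> Z" "b \<notin> Z" "i \<noteq> a" "i \<noteq> b" using assms(7) ne by (auto simp: Z_def)
  have "insert i Z \<in> D" "insert a (insert b Z) \<in> D" using assms(2,3) eq by simp_all
  from mexch_exchange_12[OF assms(1) this notin ne(1)] show ?thesis
    unfolding eq(2) unfolding eq(3-6) using eq(1) by auto
next
  case (Some c)
  then have c: "c \<notin> Y" "c \<noteq> i" using assms(6,8) by auto
  show ?thesis
  proof (cases d; cases e)
    assume "d = None" "e = None"
    then have eq: "swap (swap Y d k) e (Some i) = insert i (insert c Y)"
      "swap Y d k = insert c Y" "swap Y e (Some i) = insert i Y" using Some by (auto simp: swap_def)
    show ?thesis using mexch_submodular[OF assms(1,2), of i c] assms(3)[unfolded eq(1)] assms(7) c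
      unfolding eq(1) unfolding eq(2,3) by simp
  next
    fix a assume de: "d = Some a" "e = None"
    define Z where "Z = Y - {a}"
    have a: "a \<in> Y" using assms(4) de by auto
    have eq: "Y = insert a Z" "swap (swap Y d k) e (Some i) = insert i (insert c Z)"
      "swap Y d k = insert c Z" "swap Y e (Some i) = insert i (insert a Z)"
      "swap Y e k = insert c (insert a Z)" "swap Y d (Some i) = insert i Z"
      using a de Some by (auto simp: swap_def Z_def)
    have "insert a Z \<in> D" "insert i (insert c Z) \<in> D" using assms(2,3) eq by simp_all
    moreover have "i \<notin> Z" "a \<notin> Z" "c \<notin> Z" "i \<noteq> a" "i \<noteq> c" "a \<noteq> c"
      using a c assms(7) by (auto simp: Z_def)
    ultimately show ?thesis using mexch_exchange_21[OF assms(1), of a Z i c]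
      unfolding eq(2) unfolding eq(3-6) using eq(1) by auto
  next
    fix b assume de: "d = None" "e = Some b"
    define Z where "Z = Y - {b}"
    have b: "b \<in> Y" using assms(5) de by auto
    have eq: "Y = insert b Z" "swap (swap Y d k) e (Some i) = insert i (insert c Z)"
      "swap Y e k = insert c Z" "swap Y d (Some i) = insert i (insert b Z)"
      "swap Y d k = insert c (insert b Z)" "swap Y e (Some i) = insert i Z"
      using b c de Some by (auto simp: swap_def Z_def)
    have "insert b Z \<in> D" "insert i (insert c Z) \<in> D" using assms(2,3) eq by simp_all
    moreover have "i \<notin> Z" "b \<notin> Z" "c \<notin> Z" "i \<noteq> b" "i \<noteq> c" "b \<noteq> c"
      using b c assms(7) by (auto simp: Z_def)
    ultimately show ?thesis using mexch_exchange_21[OF assms(1), of b Z i c]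
      unfolding eq(2) unfolding eq(3-6) using eq(1) by auto
  next
    fix a b assume de: "d = Some a" "e = Some b"
    then have ne: "a \<noteq> b" "a \<in> Y" "b \<in> Y" using assms(4,5,9) by auto
    define Z where "Z = Y - {a, b}"
    have eq: "Y = insert a (insert b Z)" "swap (swap Y d k) e (Some i) = insert i (insert c Z)"
      "swap Y d k = insert c (insert b Z)" "swap Y e k = insert c (insert a Z)"
      "swap Y e (Some i) = insert i (insert a Z)" "swap Y d (Some i) = insert i (insert b Z)"
      using ne c de Some by (auto simp: swap_def Z_def)
    have "insert a (insert b Z) \<in> D" "insert i (insert c Z) \<in> D" using assms(2,3) eq by simp_all
    moreover have "i \<notin> Z" "a \<notin> Z" "c \<notin> Z" "b \<notin> Z" "distinct [i, c, a, b]"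
      using ne c assms(7) by (auto simp: Z_def)
    ultimately show ?thesis using mexch_exchange_22[OF assms(1), of i c Z a b]
      unfolding eq(2) unfolding eq(3-6) using eq(1) by auto
  qed
qed

section \<open>Feasible single swaps at Y towards X that avoid i\<close>

text \<open>Exchange some \<open>k\<close> from \<open>X\<close> for a set \<open>J\<close>. If
  \<open>J\<close> has at most one element, the new set on the side of \<open>Y\<close> is already a
  single swap. Otherwise the new set on the side of \<open>X\<close> is closer to \<open>Y\<close>
  and still satisfies the cardinality condition, so induction applies.\<close>

lemma mexch_near_ge:
  assumes "mexch D g" "Y \<in> D" "finite Y"
  shows "\<lbrakk>X \<in> D; finite X; card (Y - X) \<le> card (X - Y); \<not> X - Y \<subseteq> {i}\<rbrakk> \<Longrightarrow>
    \<exists>k\<in>X - Y - {i}. \<exists>d. set_option d \<subseteq> Y - X \<and> swap Y d (Some k) \<in> D"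
proof (induction "card (X - Y)" arbitrary: X rule: less_induct)
  case less
  obtain k where k: "k \<in> X - Y" "k \<noteq> i" using less.prems(4) by auto
  from mexchD[OF assms(1) less.prems(1) assms(2) k(1)] obtain J where
    J: "J \<subseteq> Y - X" "(X - {k}) \<union> J \<in> D" "insert k (Y - J) \<in> D" by blast
  let ?X = "(X - {k}) \<union> J"
  have fin: "finite J" using J(1) assms(3) by (auto intro: finite_subset)
  have dX: "?X - Y = X - Y - {k}" "Y - ?X = Y - X - J" using J(1) k by auto
  have cX: "card (?X - Y) = card (X - Y) - 1" "card (X - Y) > 0" "card (Y - ?X) = card (Y - X) - card J"
    "card J \<le> card (Y - X)"
    unfolding dX using k less.prems(2) assms(3) J(1) fin
    by (auto simp: card_Diff_subset card_gt_0_iff intro: card_mono)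
  consider "card J = 0" | "card J = 1" | "card J \<ge> 2" by linarith
  then show ?case
  proof cases
    case 1
    then have "swap Y None (Some k) \<in> D" using J fin by (simp add: swap_def)
    then show ?thesis using k by fastforce
  next
    case 2
    then obtain a where "J = {a}" by (auto simp: card_1_singleton_iff)
    then have "swap Y (Some a) (Some k) \<in> D" "set_option (Some a) \<subseteq> Y - X"
      using J by (simp_all add: swap_def)
    then show ?thesis using k by blast
  next
    case 3
    show ?thesis
    proof (cases "?X - Y \<subseteq> {i}")
      case False
      have "\<exists>k\<in>?X - Y - {i}. \<exists>d. set_option d \<subseteq> Y - ?X \<and> swap Y d (Some k) \<in> D"
      proof (rule less.hyps)
        show "card (?X - Y) < card (X - Y)" "card (Y - ?X) \<le> card (?X - Y)"
          using cX less.prems(3) 3 by linarith+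
      qed (use False less.prems J fin in auto)
      then obtain k' d where "k' \<in> ?X - Y - {i}" "set_option d \<subseteq> Y - ?X" "swap Y d (Some k') \<in> D"
        by blast
      moreover from this have "k' \<in> X - Y - {i}" "set_option d \<subseteq> Y - X" unfolding dX by auto
      ultimately show ?thesis by blast
    next
      case True
      \<comment> \<open>Induction is blocked when only \<open>i\<close> may remain in the
        difference. Then the cardinalities force \<open>X\<close> to be two swaps away from
        \<open>Y\<close>, and the local exchange supplies a swap that brings in
        \<open>k\<close>.\<close>
      then have sub: "X - Y \<subseteq> {i, k}" using dX by auto
      then have "card (X - Y) \<le> 2" using card_mono[OF _ sub] k by simp
      then have c2: "card (X - Y) = 2" "card (Y - X) = 2" using cX less.prems(3) 3 by linarith+
      have XY: "X - Y = {i, k}"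
        using c2(1) sub k by (intro card_subset_eq) auto
      obtain a b where ab: "Y - X = {a, b}" "a \<noteq> b" using c2(2) by (auto simp: card_2_iff)
      have "swap (swap Y (Some a) (Some k)) (Some b) (Some i) = X"
        using XY ab by (auto simp: swap_def)
      then have "swap Y (Some a) (Some k) \<in> D \<or> swap Y (Some b) (Some k) \<in> D"
        using mexch_local[OF assms(1,2), of "Some a" "Some k" "Some b" i] XY ab less.prems(1) k
        by auto
      moreover have "set_option (Some a) \<subseteq> Y - X" "set_option (Some b) \<subseteq> Y - X" using ab by auto
      moreover have "k \<in> X - Y - {i}" using k by simp
      ultimately show ?thesis by metis
    qed
  qed
qed

text \<open>Exchange some \<open>a\<close> from \<open>Y\<close> for a set \<open>K\<close>. Unless
  this is already a wanted swap, \<open>K\<close> is nonempty, so replacing \<open>X\<close> by the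
  exchanged set shrinks \<open>X - Y\<close> at least as much as \<open>Y - X\<close> and the strict
  inequality survives.\<close>

lemma mexch_near_less:
  assumes "mexch D g" "Y \<in> D" "finite Y"
  shows "\<lbrakk>X \<in> D; finite X; card (X - Y) < card (Y - X)\<rbrakk> \<Longrightarrow>
    \<exists>a k. a \<in> Y - X \<and> set_option k \<subseteq> X - Y - {i} \<and> swap Y (Some a) k \<in> D"
proof (induction "card (Y - X)" arbitrary: X rule: less_induct)
  case less
  obtain a where a: "a \<in> Y - X"
    using less.prems(3) by (metis card.empty equals0I not_less_zero)
  from mexchD[OF assms(1,2) less.prems(1) a] obtain K where
    K: "K \<subseteq> X - Y" "(Y - {a}) \<union> K \<in> D" "insert a (X - K) \<in> D" by blast
  have fin: "finite K" using K(1) less.prems(2) by (auto intro: finite_subset)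
  let ?X = "insert a (X - K)"
  show ?case
  proof (cases "\<exists>k. K = set_option k \<and> k \<noteq> Some i")
    case True
    then obtain k where "K = set_option k" "k \<noteq> Some i" by blast
    then have "swap Y (Some a) k \<in> D" "set_option k \<subseteq> X - Y - {i}"
      using K by (cases k; auto simp: swap_def)+
    then show ?thesis using a by blast
  next
    case False
    then have "K \<noteq> {}" by (metis option.distinct(1) option.set(1))
    then have cK: "card K > 0" using fin by (simp add: card_gt_0_iff)
    have d: "Y - ?X = Y - X - {a}" "?X - Y = X - Y - K" using a K(1) by auto
    have c: "card (Y - ?X) = card (Y - X) - 1" "card (?X - Y) = card (X - Y) - card K"
      "card K \<le> card (X - Y)" "card (Y - X) > 0"
      unfolding d using a assms(3) less.prems(2) K(1) fin
      by (auto simp: card_Diff_subset card_gt_0_iff intro: card_mono)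
    have "\<exists>a k. a \<in> Y - ?X \<and> set_option k \<subseteq> ?X - Y - {i} \<and> swap Y (Some a) k \<in> D"
    proof (rule less.hyps)
      show "card (Y - ?X) < card (Y - X)" "card (?X - Y) < card (Y - ?X)"
        using c cK less.prems(3) by linarith+
    qed (use less.prems K in auto)
    then obtain a' k where "a' \<in> Y - ?X" "set_option k \<subseteq> ?X - Y - {i}" "swap Y (Some a') k \<in> D"
      by blast
    moreover from this have "a' \<in> Y - X" "set_option k \<subseteq> X - Y - {i}" unfolding d by auto
    ultimately show ?thesis by blast
  qed
qed

text \<open>For finite sets the extra condition permits a pure removal only if \<open>X\<close> has
  more elements than \<open>Y\<close>. The set \<open>X\<close> stays fixed while the induction
  moves \<open>Y\<close> towards it.\<close>

lemma mexch_exchange: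
  assumes "mexch D g" "X \<in> D" "finite X"
  shows "\<lbrakk>Y \<in> D; finite Y; i \<in> X - Y\<rbrakk> \<Longrightarrow>
    \<exists>e. set_option e \<subseteq> Y - X \<and> (e = None \<longrightarrow> card (Y - X) < card (X - Y)) \<and>
     swap X (Some i) e \<in> D \<and> swap Y e (Some i) \<in> D \<and>
     g X + g Y \<le> g (swap X (Some i) e) + g (swap Y e (Some i))"
proof (induction "card (X - Y) + card (Y - X)" arbitrary: Y rule: less_induct)
  case less
  define ok where "ok Y e \<longleftrightarrow> set_option e \<subseteq> Y - X \<and> (e = None \<longrightarrow> card (Y - X) < card (X - Y))" for Y e
  let ?X = "\<lambda>e. swap X (Some i) e" and ?Y = "\<lambda>e. swap Y e (Some i)"
  show ?case
  proof (rule ccontr)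
    assume "\<not> ?thesis"
    then have fail: "g (?X e) + g (?Y e) < g X + g Y" if "ok Y e" "?X e \<in> D" "?Y e \<in> D" for e
      using that unfolding ok_def by (metis not_le)
    \<comment> \<open>A price for each admissible \<open>e\<close>: exchanging at \<open>X\<close> gains nothing, exchanging at \<open>Y\<close> strictly loses.\<close>
    define q where "q e = (if ?X e \<in> D then g X - g (?X e) else g (?Y e) - g Y + 1)" for e
    have qX: "g (?X e) = g X - q e" if "?X e \<in> D" for e
      using that by (simp add: q_def)
    have qY: "g (?Y e) < g Y + q e" if "ok Y e" "?Y e \<in> D" for e
      using that fail[of e] by (auto simp: q_def)
    \<comment> \<open>Any neighbour of \<open>Y\<close> closer to \<open>X\<close> is contradictory
      if it has no new admissible \<open>e\<close> and the price bound \<open>qY\<close> persists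
      there: by \<open>qX\<close>, the exchange that induction yields for it violates that
      bound.\<close>
    have descend: False
      if Y': "swap Y d k \<in> D" and dk: "set_option d \<subseteq> Y - X" "set_option k \<subseteq> X - Y - {i}"
        "d \<noteq> None \<or> k \<noteq> None"
      and okY: "\<And>e. ok (swap Y d k) e \<Longrightarrow> ok Y e"
      and lt: "\<And>e. ok (swap Y d k) e \<Longrightarrow> ok Y e \<Longrightarrow> swap (swap Y d k) e (Some i) \<in> D \<Longrightarrow>
        g (swap (swap Y d k) e (Some i)) < g (swap Y d k) + q e" for d k
    proof -
      let ?Z = "swap Y d k"
      have sub: "?Z - X \<subseteq> Y - X" "X - ?Z \<subseteq> X - Y" using dk by (auto simp: swap_def)
      have "?Z - X \<subset> Y - X \<or> X - ?Z \<subset> X - Y"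
        using dk by (cases d; cases k) (auto simp: swap_def)
      then have "card (X - ?Z) + card (?Z - X) < card (X - Y) + card (Y - X)"
        using sub assms(3) less.prems(2)
        by (meson add_le_less_mono add_less_le_mono card_mono finite_Diff psubset_card_mono)
      moreover have "finite ?Z" "i \<in> X - ?Z"
        using less.prems dk by (cases k; auto simp: swap_def)+
      ultimately obtain e where e: "ok ?Z e" "?X e \<in> D" "swap ?Z e (Some i) \<in> D"
        "g X + g ?Z \<le> g (?X e) + g (swap ?Z e (Some i))"
        using less.hyps[of ?Z] Y' unfolding ok_def by blast
      show False using lt[OF e(1) okY[OF e(1)] e(3)] qX[OF e(2)] e(4) by linarith
    qed
    have card_swap: "card (swap Y d k - X) = card (Y - X) - card (set_option d)"
      "card (X - swap Y d k) = card (X - Y) - card (set_option k)"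
      if dk: "set_option d \<subseteq> Y - X" "set_option k \<subseteq> X - Y - {i}" for d k
    proof -
      have "swap Y d k - X = Y - X - set_option d" "X - swap Y d k = X - Y - set_option k"
        using dk by (auto simp: swap_def)
      then show "card (swap Y d k - X) = card (Y - X) - card (set_option d)"
        "card (X - swap Y d k) = card (X - Y) - card (set_option k)"
        using dk by (auto intro!: card_Diff_subset)
    qed
    \<comment> \<open>For fixed \<open>k\<close>, the neighbour chosen is the one whose removed
      element \<open>d\<close> maximizes the value minus its price \<open>q d\<close>.\<close>
    have descend_max: False
      if k: "set_option k \<subseteq> X - Y - {i}" "k = None \<Longrightarrow> card (X - Y) < card (Y - X)"
        and ex: "ok Y d0" "swap Y d0 k \<in> D" for k d0
    proof -
      let ?S = "{d. ok Y d \<and> swap Y d k \<in> D}"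
      have "?S \<subseteq> insert None (Some ` (Y - X))"
      proof
        fix d assume "d \<in> ?S"
        then show "d \<in> insert None (Some ` (Y - X))" by (cases d) (auto simp: ok_def)
      qed
      then have "finite ?S" using less.prems(2) by (auto intro: finite_subset)
      moreover have "?S \<noteq> {}" using ex by blast
      ultimately obtain d where d: "d \<in> ?S"
        "\<And>d'. d' \<in> ?S \<Longrightarrow> g (swap Y d' k) - q d' \<le> g (swap Y d k) - q d"
        using ex_max_on_finite[of ?S "\<lambda>d. g (swap Y d k) - q d"] by blast
      have dok: "ok Y d" "swap Y d k \<in> D" and dsub: "set_option d \<subseteq> Y - X"
        using d(1) by (auto simp: ok_def)
      have kn: "e \<noteq> None" if "k = None" "ok Y e" for e
        using k(2)[OF that(1)] that(2) by (auto simp: ok_def)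
      show False
      proof (rule descend[OF dok(2) dsub k(1)])
        show "d \<noteq> None \<or> k \<noteq> None" using kn dok(1) by blast
        show okY: "ok Y e" if e: "ok (swap Y d k) e" for e
        proof -
          have "set_option e \<subseteq> Y - X" using e k(1) by (auto simp: ok_def swap_def)
          \<comment> \<open>For \<open>d = None\<close> the inequality is the admissibility of
            \<open>d\<close>. If \<open>d\<close> and \<open>k\<close> are both elements, the two
            cardinalities drop by one together. If only \<open>d\<close> is one, the assumption on
            \<open>k = None\<close> makes \<open>e = None\<close> inadmissible at the
            neighbour.\<close>
          moreover have "card (Y - X) < card (X - Y)" if "e = None"
            using e that card_swap[OF dsub k(1)] dok(1) k(2)
            by (cases d; cases k) (auto simp: ok_def)
          ultimately show ?thesis by (simp add: ok_def)
        qed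
        fix e assume e: "ok (swap Y d k) e" "ok Y e" "swap (swap Y d k) e (Some i) \<in> D"
        have "set_option d \<subseteq> Y" "set_option e \<subseteq> Y" "set_option k \<inter> Y = {}" "i \<notin> Y" "k \<noteq> Some i"
          using dsub e(2) k(1) less.prems(3) by (auto simp: ok_def)
        moreover have "d = None" if "d = e"
          using e(1) that k(1) dsub by (cases d) (auto simp: ok_def swap_def)
        moreover have "k = None \<Longrightarrow> d \<noteq> None \<and> e \<noteq> None" using kn dok(1) e(2) by blast
        \<comment> \<open>In the first alternative the price bound for \<open>e\<close> at
          \<open>Y\<close> suffices; in the second the price bound for \<open>d\<close> is combined
          with the maximality of \<open>d\<close> over \<open>e\<close>.\<close>
        ultimately consider
          "?Y e \<in> D" "g Y + g (swap (swap Y d k) e (Some i)) \<le> g (swap Y d k) + g (?Y e)"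
          | "swap Y e k \<in> D" "?Y d \<in> D"
            "g Y + g (swap (swap Y d k) e (Some i)) \<le> g (swap Y e k) + g (?Y d)"
          using mexch_local[OF assms(1) less.prems(1) e(3)] by blast
        then show "g (swap (swap Y d k) e (Some i)) < g (swap Y d k) + q e"
        proof cases
          case 1
          then show ?thesis using qY[OF e(2)] by linarith
        next
          case 2
          then show ?thesis using qY[OF dok(1)] d(2)[of e] e(2) by simp
        qed
      qed
    qed
    show False
    proof (cases "card (X - Y) < card (Y - X)")
      case True
      then obtain a k where "a \<in> Y - X" "set_option k \<subseteq> X - Y - {i}" "swap Y (Some a) k \<in> D"
        using mexch_near_less[OF assms(1) less.prems(1,2) assms(2,3)] by blast
      then show False using descend_max[of k "Some a"] True by (auto simp: ok_def)
    next
      case ge: False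
      show False
      proof (cases "X - Y \<subseteq> {i}")
        case True
        then have Xi: "X - Y = {i}" using less.prems(3) by auto
        then have "card (Y - X) \<le> 1" using ge by simp
        then consider "Y - X = {}" | a where "Y - X = {a}"
          using less.prems(2) by (metis card_0_eq card_1_singletonE finite_Diff le_less less_one)
        then show False
        proof cases
          case 1
          \<comment> \<open>At this distance the exchange merely interchanges \<open>X\<close> and
            \<open>Y\<close>, so the strict inequality \<open>fail\<close> cannot hold.\<close>
          have "?X None = Y" "?Y None = X" using 1 Xi by (auto simp: swap_def)
          then show False using fail[of None] 1 Xi assms(2) less.prems(1) by (auto simp: ok_def)
        next
          case 2
          have "?X (Some a) = Y" "?Y (Some a) = X" using 2 Xi by (auto simp: swap_def)
          then show False using fail[of "Some a"] 2 assms(2) less.prems(1) by (auto simp: ok_def)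
        qed
      next
        case False
        then obtain k d where k: "k \<in> X - Y - {i}" and d: "set_option d \<subseteq> Y - X" "swap Y d (Some k) \<in> D"
          using mexch_near_ge[OF assms(1) less.prems(1,2) assms(2,3)] ge by (meson not_less)
        have ksub: "set_option (Some k) \<subseteq> X - Y - {i}" using k by simp
        have no: "\<not> (ok Y d \<and> swap Y d (Some k) \<in> D)" for d
          using descend_max[OF ksub] by blast
        then have dN: "d = None" using d by (auto simp: ok_def)
        have eq: "card (Y - X) = card (X - Y)" using no d dN ge by (auto simp: ok_def)
        \<comment> \<open>Only a pure addition of \<open>k\<close> to \<open>Y\<close> is feasible, although \<open>None\<close> is not admissible.\<close>
        show False
        proof (rule descend[OF d(2,1) ksub])
          fix e assume e: "ok (swap Y d (Some k)) e"
          have "e \<noteq> None" using e card_swap[OF d(1) ksub] eq dN by (auto simp: ok_def)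
          then obtain a where a: "e = Some a" by blast
          show eY: "ok Y e" using e k a by (auto simp: ok_def swap_def dN)
          assume Z: "swap (swap Y d (Some k)) e (Some i) \<in> D"
          have "swap Y e (Some k) \<notin> D" using no eY by blast
          then have "?Y e \<in> D \<and> g Y + g (swap (swap Y d (Some k)) e (Some i)) \<le>
              g (swap Y d (Some k)) + g (?Y e)"
            using mexch_local[OF assms(1) less.prems(1) Z] eY dN a k less.prems(3)
            by (auto simp: ok_def)
          then show "g (swap (swap Y d (Some k)) e (Some i)) < g (swap Y d (Some k)) + q e"
            using qY[OF eY] by linarith
        qed simp
      qed
    qed
  qed
qed

lemma mexch_imp_mnat:
  assumes "mexch D g" "\<And>X. X \<in> D \<Longrightarrow> finite X"
  shows "mnat D g"
  unfolding mnat_def using mexch_exchange[OF assms(1)] assms(2) by blast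

section \<open>Partition by exchange paths and prices\<close>

definition maximizers :: "'a set set \<Rightarrow> ('a set \<Rightarrow> real) \<Rightarrow> 'a set set" where
  "maximizers D g = {A \<in> D. \<forall>S\<in>D. g S \<le> g A}"

text \<open>For both sets of the pair, arcs run from the element leaving to the element entering. A
  path in the union of both arc sets thus carries surplus coverage towards uncovered elements; the
  dummy \<open>None\<close> allows additions and removals.\<close>

definition exch_arcs :: "'a set set \<Rightarrow> 'a set \<Rightarrow> ('a option \<times> 'a option) set" where
  "exch_arcs M A = {(x, y). set_option x \<subseteq> A \<and> set_option y \<inter> A = {} \<and> swap A x y \<in> M}"

text \<open>For subsets of \<open>E\<close>, this counts the elements not covered exactly once, so
  zero means that \<open>A\<close> and \<open>B\<close> partition \<open>E\<close>.\<close>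

definition defect :: "'a set \<Rightarrow> 'a set \<Rightarrow> 'a set \<Rightarrow> nat" where
  "defect E A B = card (A \<inter> B) + card (E - (A \<union> B))"

text \<open>An exchange between two maximizers cannot lose in total and cannot gain in either set,
  so both results are maximizers. The zero function leaves only the exchange property of the
  family.\<close>

lemma mnat_maximizers:
  assumes "mnat D g"
  shows "mnat (maximizers D g) (\<lambda>_. 0)"
  unfolding mnat_def
proof (intro ballI)
  fix X Y i assume X: "X \<in> maximizers D g" and Y: "Y \<in> maximizers D g" and i: "i \<in> X - Y"
  then have XY: "X \<in> D" "Y \<in> D" "\<And>S. S \<in> D \<Longrightarrow> g S \<le> g X" "\<And>S. S \<in> D \<Longrightarrow> g S \<le> g Y"
    by (auto simp: maximizers_def)
  obtain e where e: "set_option e \<subseteq> Y - X" "swap X (Some i) e \<in> D" "swap Y e (Some i) \<in> D"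
    "g X + g Y \<le> g (swap X (Some i) e) + g (swap Y e (Some i))"
    using mnatD[OF assms XY(1,2) i] .
  have "g (swap X (Some i) e) = g X" "g (swap Y e (Some i)) = g Y"
    using XY(3)[OF e(2)] XY(4)[OF e(3)] e(4) by linarith+
  then have "swap X (Some i) e \<in> maximizers D g" "swap Y e (Some i) \<in> maximizers D g"
    using XY e(2,3) by (auto simp: maximizers_def)
  then show "\<exists>e. set_option e \<subseteq> Y - X \<and> swap X (Some i) e \<in> maximizers D g \<and>
      swap Y e (Some i) \<in> maximizers D g \<and> (0::real) + 0 \<le> 0 + 0"
    using e(1) by auto
qed

lemma sum_swap:
  fixes p :: "'a \<Rightarrow> real"
  assumes "finite S" "set_option x \<subseteq> S" "set_option y \<inter> S = {}"
  shows "sum p (swap S x y) = sum p S - sum p (set_option x) + sum p (set_option y)"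
proof -
  have "sum p (swap S x y) = sum p (S - set_option x) + sum p (set_option y)"
    unfolding swap_def using assms by (intro sum.union_disjoint) auto
  also have "sum p (S - set_option x) = sum p S - sum p (set_option x)"
    using assms by (intro sum_diff) auto
  finally show ?thesis .
qed

lemma mnat_add_linear:
  assumes "mnat D g" "\<And>X. X \<in> D \<Longrightarrow> finite X"
  shows "mnat D (\<lambda>S. g S + sum p S)"
  unfolding mnat_def
proof (intro ballI)
  fix X Y i assume XY: "X \<in> D" "Y \<in> D" and i: "i \<in> X - Y"
  obtain e where e: "set_option e \<subseteq> Y - X" "swap X (Some i) e \<in> D" "swap Y e (Some i) \<in> D"
    "g X + g Y \<le> g (swap X (Some i) e) + g (swap Y e (Some i))"
    using mnatD[OF assms(1) XY i] .
  have "sum p (swap X (Some i) e) = sum p X - p i + sum p (set_option e)"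
    "sum p (swap Y e (Some i)) = sum p Y - sum p (set_option e) + p i"
    using sum_swap[of X "Some i" e p] sum_swap[of Y e "Some i" p] assms(2) XY i e(1) by auto
  then show "\<exists>e. set_option e \<subseteq> Y - X \<and> swap X (Some i) e \<in> D \<and> swap Y e (Some i) \<in> D \<and>
      g X + sum p X + (g Y + sum p Y) \<le> g (swap X (Some i) e) + sum p (swap X (Some i) e) +
        (g (swap Y e (Some i)) + sum p (swap Y e (Some i)))"
    using e by (intro exI[of _ e]) auto
qed

text \<open>Exchanging between \<open>S\<close> and \<open>A\<close> yields one set a single swap
  from \<open>A\<close>, which is no better than \<open>A\<close>, hence another set closer to
  \<open>A\<close> that is at least as good as \<open>S\<close>.\<close>

lemma mnat_local_max:
  assumes "mnat D h" "A \<in> D" "finite A" "\<And>S. S \<in> D \<Longrightarrow> finite S"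
    and loc: "\<And>x y. set_option x \<subseteq> A \<Longrightarrow> set_option y \<inter> A = {} \<Longrightarrow> swap A x y \<in> D \<Longrightarrow> h (swap A x y) \<le> h A"
  shows "A \<in> maximizers D h"
proof -
  have "h S \<le> h A" if "S \<in> D" for S
    using that
  proof (induction "card (S - A) + card (A - S)" arbitrary: S rule: less_induct)
    case less
    have step: ?case if T: "T \<in> D" "h S \<le> h T" "T - A \<subseteq> S - A" "A - T \<subseteq> A - S"
      "T - A \<subset> S - A \<or> A - T \<subset> A - S" for T
    proof -
      have "card (T - A) + card (A - T) < card (S - A) + card (A - S)"
        using T(3-5) assms(3) assms(4)[OF less.prems]
        by (meson add_le_less_mono add_less_le_mono card_mono finite_Diff psubset_card_mono)
      then show ?case using less.hyps T(1,2) by fastforce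
    qed
    consider "S = A" | i where "i \<in> S - A" | i where "i \<in> A - S" by blast
    then show ?case
    proof cases
      case 2
      from mnatD[OF assms(1) less.prems assms(2) this] obtain e where
        e: "set_option e \<subseteq> A - S" "swap S (Some i) e \<in> D" "swap A e (Some i) \<in> D"
        "h S + h A \<le> h (swap S (Some i) e) + h (swap A e (Some i))" by blast
      have "h (swap A e (Some i)) \<le> h A" using e 2 by (intro loc) auto
      then show ?thesis
        using e 2 by (intro step[of "swap S (Some i) e"]) (auto simp: swap_def)
    next
      case 3
      from mnatD[OF assms(1,2) less.prems this] obtain e where
        e: "set_option e \<subseteq> S - A" "swap A (Some i) e \<in> D" "swap S e (Some i) \<in> D"
        "h A + h S \<le> h (swap A (Some i) e) + h (swap S e (Some i))" by blast
      have "h (swap A (Some i) e) \<le> h A" using e 3 by (intro loc) auto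
      then show ?thesis
        using e 3 by (intro step[of "swap S e (Some i)"]) (auto simp: swap_def)
    qed simp
  qed
  then show ?thesis using assms(2) by (simp add: maximizers_def)
qed

text \<open>The missing arcs into \<open>t\<close> are the shortcuts that a shortest path excludes.\<close>

lemma exch_arcs_preserved:
  assumes M: "mnat M (\<lambda>_. 0)" and xy: "(x, y) \<in> exch_arcs M A" and ut: "(Some u, Some t) \<in> exch_arcs M A"
    and no: "(x, Some t) \<notin> exch_arcs M A" "(None, Some t) \<notin> exch_arcs M A" and "y \<noteq> Some t"
  shows "(x, y) \<in> exch_arcs M (swap A (Some u) (Some t))"
proof -
  let ?X = "swap A x y" and ?Y = "swap A (Some u) (Some t)"
  have A: "set_option x \<subseteq> A" "set_option y \<inter> A = {}" "?X \<in> M" "u \<in> A" "t \<notin> A" "?Y \<in> M"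
    using xy ut by (auto simp: exch_arcs_def)
  have xu: "x \<noteq> Some u" using no(1) ut by auto
  have nM: "swap A x (Some t) \<notin> M" "swap A None (Some t) \<notin> M"
    using no A by (auto simp: exch_arcs_def)
  have "u \<in> ?X - ?Y" using A xu by (cases x) (auto simp: swap_def)
  then obtain e where e: "set_option e \<subseteq> ?Y - ?X" "swap ?X (Some u) e \<in> M" "swap ?Y e (Some u) \<in> M"
    using mnatD[OF M A(3,6)] by blast
  \<comment> \<open>The partner of \<open>u\<close> is the dummy, the element of \<open>x\<close>,
    or \<open>t\<close>. The first two would produce one of the shortcuts into \<open>t\<close> that
    are excluded, so it is \<open>t\<close>.\<close>
  have "e \<noteq> None"
  proof
    assume "e = None"
    then have "swap ?Y e (Some u) = swap A None (Some t)" using A by (auto simp: swap_def)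
    then show False using e(3) nM by simp
  qed
  moreover have "e \<noteq> x"
  proof
    assume ex: "e = x"
    then have "swap ?Y e (Some u) = swap A x (Some t)" using A xu by (cases x) (auto simp: swap_def)
    then show False using e(3) nM by simp
  qed
  moreover have "?Y - ?X \<subseteq> insert t (set_option x)" by (auto simp: swap_def)
  ultimately have "e = Some t" using e(1) by (cases e; cases x) auto
  then have "swap ?X (Some u) e = swap ?Y x y" using A xu by (cases x; cases y) (auto simp: swap_def)
  then have "swap ?Y x y \<in> M" using e(2) by simp
  moreover have "set_option x \<subseteq> ?Y" using A(1) xu by (cases x) (auto simp: swap_def)
  moreover have "set_option y \<inter> ?Y = {}"
    using A(2) \<open>y \<noteq> Some t\<close> by (cases y) (auto simp: swap_def)
  ultimately show ?thesis by (simp add: exch_arcs_def)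
qed

text \<open>
  Performing the exchange of the last arc of a shortest path either decreases the defect or moves the
  endpoint of the path one step closer to its source.
\<close>

lemma augment_step:
  assumes M: "mnat M (\<lambda>_. 0)" and fin: "finite E" "A \<subseteq> E"
    and f: "\<And>j. j < Suc k \<Longrightarrow> (f j, f (Suc j)) \<in> exch_arcs M A \<union> R" "f (Suc k) = Some t" "t \<in> E - (A \<union> B)"
    and last: "(f k, Some t) \<in> exch_arcs M A"
    and src: "f 0 \<in> insert None (Some ` (A \<inter> B))"
    and short: "\<And>j. j < k \<Longrightarrow> (f j, Some t) \<notin> exch_arcs M A"
      "k \<noteq> 0 \<Longrightarrow> (None, Some t) \<notin> exch_arcs M A"
      "\<And>j. j < k \<Longrightarrow> f (Suc j) \<notin> insert None (Some ` (A \<inter> B))"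
      "\<And>j. j < Suc k \<Longrightarrow> f j \<notin> Some ` (E - (A \<union> B))"
  shows "\<exists>A'\<in>M. defect E A' B < defect E A B \<or>
    defect E A' B = defect E A B \<and> (\<exists>x\<in>insert None (Some ` (A' \<inter> B)). \<exists>y\<in>Some ` (E - (A' \<union> B)).
      (x, y) \<in> (exch_arcs M A' \<union> R) ^^ k)"
proof (cases k)
  case 0
  \<comment> \<open>The source is the dummy or an element that \<open>B\<close> still covers, so
    covering \<open>t\<close> leaves nothing newly uncovered.\<close>
  let ?A = "swap A (f 0) (Some t)"
  have "?A \<in> M" using last 0 by (auto simp: exch_arcs_def)
  moreover have "defect E ?A B < defect E A B"
  proof -
    have "E - (?A \<union> B) \<subset> E - (A \<union> B)"
      using f(3) src by (cases "f 0") (auto simp: swap_def)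
    then have "card (E - (?A \<union> B)) < card (E - (A \<union> B))" using fin by (intro psubset_card_mono) auto
    moreover have "?A \<inter> B \<subseteq> A \<inter> B" using f(3) by (auto simp: swap_def)
    then have "card (?A \<inter> B) \<le> card (A \<inter> B)"
      using fin by (intro card_mono) (auto intro: finite_subset)
    ultimately show ?thesis by (simp add: defect_def)
  qed
  ultimately show ?thesis by blast
next
  case (Suc m)
  then have "f k \<noteq> None" "f k \<notin> Some ` (A \<inter> B)" using short(3)[of m] by auto
  then obtain u where u: "f k = Some u" "u \<notin> A \<inter> B" by auto
  have uA: "u \<in> A" "t \<notin> A" using last u by (auto simp: exch_arcs_def)
  then have uB: "u \<notin> B" "t \<notin> B" "t \<in> E" "u \<in> E" "u \<noteq> t" using u f(3) fin by auto
  \<comment> \<open>Only \<open>A\<close> covers \<open>u\<close>, so \<open>u\<close> takes the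
    place of \<open>t\<close> as an uncovered element and the path is shortened by its last
    arc.\<close>
  let ?A = "swap A (Some u) (Some t)"
  have AM: "?A \<in> M" using last u by (auto simp: exch_arcs_def)
  have AB: "?A \<inter> B = A \<inter> B" "E - (?A \<union> B) = insert u (E - (A \<union> B) - {t})"
    using uA uB by (auto simp: swap_def)
  have "card (E - (?A \<union> B)) = card (E - (A \<union> B))"
    unfolding AB using uA uB fin by (subst card.remove[of "E - (A \<union> B)" t]) auto
  then have def: "defect E ?A B = defect E A B" using AB(1) by (simp add: defect_def)
  have "(f j, f (Suc j)) \<in> exch_arcs M ?A \<union> R" if j: "j < k" for j
  proof (cases "(f j, f (Suc j)) \<in> R")
    case False
    then have arc: "(f j, f (Suc j)) \<in> exch_arcs M A" using f(1)[of j] j by auto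
    have "f (Suc j) \<noteq> Some t" using short(4)[of "Suc j"] j f(3) by auto
    then have "(f j, f (Suc j)) \<in> exch_arcs M ?A"
      using short(1)[OF j] short(2) Suc last u arc by (intro exch_arcs_preserved[OF M arc]) auto
    then show ?thesis by simp
  qed simp
  then have "(f 0, f k) \<in> (exch_arcs M ?A \<union> R) ^^ k" by (auto simp: relpow_fun_conv)
  moreover have "f 0 \<in> insert None (Some ` (?A \<inter> B))" using src AB by simp
  moreover have "f k \<in> Some ` (E - (?A \<union> B))" using u AB by simp
  ultimately show ?thesis using AM def by blast
qed

text \<open>Induction on the path length. If no shorter path exists, the last arc belongs to one of
  the two sets, and \<open>augment_step\<close> applied to that set either lowers the defect or
  leaves a path with one arc less.\<close>

lemma augment:
  assumes M1: "mnat M1 (\<lambda>_. 0)" and M2: "mnat M2 (\<lambda>_. 0)" and fin: "finite E" "M1 \<subseteq> Pow E" "M2 \<subseteq> Pow E"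
  shows "\<lbrakk>A \<in> M1; B \<in> M2; x \<in> insert None (Some ` (A \<inter> B)); y \<in> Some ` (E - (A \<union> B));
    (x, y) \<in> (exch_arcs M1 A \<union> exch_arcs M2 B) ^^ k\<rbrakk> \<Longrightarrow>
    \<exists>A'\<in>M1. \<exists>B'\<in>M2. defect E A' B' < defect E A B"
proof (induction k arbitrary: A B x y rule: less_induct)
  case (less k)
  let ?R = "exch_arcs M1 A \<union> exch_arcs M2 B"
  let ?S = "insert None (Some ` (A \<inter> B))" and ?T = "Some ` (E - (A \<union> B))"
  have AB: "A \<subseteq> E" "B \<subseteq> E" using less.prems fin by auto
  show ?case
  proof (cases "\<exists>k'<k. \<exists>x\<in>?S. \<exists>y\<in>?T. (x, y) \<in> ?R ^^ k'")
    case True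
    then show ?thesis using less.IH less.prems(1,2) by blast
  next
    case False
    then have min: "(x, y) \<notin> ?R ^^ k'" if "k' < k" "x \<in> ?S" "y \<in> ?T" for x y k'
      using that by blast
    have "k \<noteq> 0" using less.prems by (cases k) auto
    then obtain m where k: "k = Suc m" by (cases k) auto
    obtain f where f: "f 0 = x" "f (Suc m) = y" "\<And>j. j < Suc m \<Longrightarrow> (f j, f (Suc j)) \<in> ?R"
      using less.prems(5) unfolding relpow_fun_conv k by blast
    obtain t where t: "y = Some t" "t \<in> E - (A \<union> B)" using less.prems(4) by blast
    have pre: "(f i, f (i + n)) \<in> ?R ^^ n" if "i + n \<le> Suc m" for i n
      using that f(3) unfolding relpow_fun_conv by (intro exI[of _ "\<lambda>j. f (i + j)"]) auto
    \<comment> \<open>Facts \<open>s1\<close> to \<open>s4\<close> express minimality: a shortcut to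
      \<open>t\<close>, an arc from the dummy to \<open>t\<close>, a later source or an earlier
      uncovered vertex would each give a shorter path.\<close>
    have s1: "(f j, Some t) \<notin> ?R" if "j < m" for j
    proof
      assume "(f j, Some t) \<in> ?R"
      then have "(x, y) \<in> ?R ^^ Suc j" using pre[of 0 j] that f(1) t by auto
      moreover have "Suc j < k" using that k by simp
      ultimately show False using min less.prems(3,4) by blast
    qed
    have s2: "(None, Some t) \<notin> ?R" if "m \<noteq> 0"
    proof
      assume "(None, Some t) \<in> ?R"
      then have "(None, y) \<in> ?R ^^ 1" using t by auto
      moreover have "1 < k" using that k by simp
      ultimately show False using min less.prems(4) by blast
    qed
    have s3: "f (Suc j) \<notin> ?S" if "j < m" for j
    proof
      assume "f (Suc j) \<in> ?S"
      moreover have "(f (Suc j), y) \<in> ?R ^^ (m - j)" using pre[of "Suc j" "m - j"] that f(2) by simp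
      moreover have "m - j < k" using k by simp
      ultimately show False using min less.prems(4) by blast
    qed
    have s4: "f j \<notin> ?T" if "j < Suc m" for j
    proof
      assume "f j \<in> ?T"
      moreover have "(x, f j) \<in> ?R ^^ j" using pre[of 0 j] that f(1) by simp
      moreover have "j < k" using that k by simp
      ultimately show False using min less.prems(3) by blast
    qed
    have "(f m, Some t) \<in> ?R" using f(2) f(3)[of m] t by auto
    then consider "(f m, Some t) \<in> exch_arcs M1 A" | "(f m, Some t) \<in> exch_arcs M2 B" by blast
    then show ?thesis
    proof cases
      case 1
      have "\<exists>A'\<in>M1. defect E A' B < defect E A B \<or>
        defect E A' B = defect E A B \<and> (\<exists>x\<in>insert None (Some ` (A' \<inter> B)). \<exists>y\<in>Some ` (E - (A' \<union> B)).
          (x, y) \<in> (exch_arcs M1 A' \<union> exch_arcs M2 B) ^^ m)"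
      proof (rule augment_step[where f = f and t = t])
        show "\<And>j. j < m \<Longrightarrow> f (Suc j) \<notin> ?S" by (rule s3)
        show "\<And>j. j < Suc m \<Longrightarrow> f j \<notin> ?T" by (rule s4)
        show "f 0 \<in> ?S" using f(1) less.prems(3) by simp
        show "f (Suc m) = Some t" using f(2) t(1) by simp
        show "\<And>j. j < Suc m \<Longrightarrow> (f j, f (Suc j)) \<in> ?R" by (rule f(3))
      qed (use M1 fin(1) AB(1) t(2) 1 s1 s2 in \<open>simp_all\<close>)
      then show ?thesis using less.IH[of m] less.prems(2) k by (metis lessI)
    next
      case 2
      have c: "A \<inter> B = B \<inter> A" "A \<union> B = B \<union> A" for A B :: "'a set" by auto
      have dc: "defect E A B = defect E B A" for A B using c by (metis defect_def)
      have "\<exists>B'\<in>M2. defect E B' A < defect E B A \<or>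
        defect E B' A = defect E B A \<and> (\<exists>x\<in>insert None (Some ` (B' \<inter> A)). \<exists>y\<in>Some ` (E - (B' \<union> A)).
          (x, y) \<in> (exch_arcs M2 B' \<union> exch_arcs M1 A) ^^ m)"
      proof (rule augment_step[where f = f and t = t])
        show "\<And>j. j < m \<Longrightarrow> f (Suc j) \<notin> insert None (Some ` (B \<inter> A))" using s3 c by metis
        show "\<And>j. j < Suc m \<Longrightarrow> f j \<notin> Some ` (E - (B \<union> A))" using s4 c by metis
        show "f 0 \<in> insert None (Some ` (B \<inter> A))" using f(1) less.prems(3) c by metis
        show "f (Suc m) = Some t" using f(2) t(1) by simp
        show "\<And>j. j < Suc m \<Longrightarrow> (f j, f (Suc j)) \<in> exch_arcs M2 B \<union> exch_arcs M1 A"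
          using f(3) by blast
        show "t \<in> E - (B \<union> A)" using t(2) by simp
      qed (use M2 fin(1) AB(2) 2 s1 s2 in \<open>simp_all\<close>)
      then obtain B' where "B' \<in> M2" "defect E A B' < defect E A B \<or>
        defect E A B' = defect E A B \<and> (\<exists>x\<in>insert None (Some ` (A \<inter> B')). \<exists>y\<in>Some ` (E - (A \<union> B')).
          (x, y) \<in> (exch_arcs M1 A \<union> exch_arcs M2 B') ^^ m)"
        unfolding c(1)[of _ A] c(2)[of _ A] dc[of _ A] Un_commute[of _ "exch_arcs M1 A"] by blast
      then show ?thesis using less.IH[of m] less.prems(1) k by (metis lessI)
    qed
  qed
qed

section \<open>Price changes and growth of the reachable set\<close>

definition frontier :: "'a option set \<Rightarrow> 'a set set \<Rightarrow> 'a set \<Rightarrow> ('a option \<times> 'a option) set" where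
  "frontier V D A = {(x, y). x \<in> V \<and> y \<notin> V \<and> set_option x \<subseteq> A \<and> set_option y \<inter> A = {} \<and> swap A x y \<in> D}"

lemma finite_frontier:
  assumes "finite E" "D \<subseteq> Pow E" "A \<subseteq> E"
  shows "finite (frontier V D A)"
proof (rule finite_subset)
  show "frontier V D A \<subseteq> insert None (Some ` E) \<times> insert None (Some ` E)"
  proof (clarify)
    fix x y assume "(x, y) \<in> frontier V D A"
    then have "set_option x \<subseteq> E" "set_option y \<subseteq> E" using assms by (auto simp: frontier_def swap_def)
    then show "x \<in> insert None (Some ` E) \<and> y \<in> insert None (Some ` E)" by (cases x; cases y) auto
  qed
qed (use assms in simp)

text \<open>Raising the prices outside of \<open>V\<close> by the smallest slack creates a new tight arc leaving \<open>V\<close>.\<close>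

lemma price_step:
  fixes p :: "'a \<Rightarrow> real"
  assumes h: "h = (\<lambda>p S. g S + sum p S)"
    and fin: "finite E" "D \<subseteq> Pow E" and D: "mnat D g" and A: "A \<in> maximizers D (h p)"
    and V: "None \<in> V" and eps: "0 \<le> \<epsilon>"
    and slack: "\<And>x y. (x, y) \<in> frontier V D A \<Longrightarrow> \<epsilon> \<le> h p A - h p (swap A x y)"
  defines "p' \<equiv> \<lambda>v. p v + (if Some v \<in> V then 0 else \<epsilon>)"
  shows "A \<in> maximizers D (h p')"
    and "\<And>x y. \<lbrakk>(x, y) \<in> exch_arcs (maximizers D (h p)) A; x \<in> V; y \<in> V\<rbrakk> \<Longrightarrow>
      (x, y) \<in> exch_arcs (maximizers D (h p')) A"
    and "\<And>x y. \<lbrakk>(x, y) \<in> frontier V D A; h p A - h p (swap A x y) = \<epsilon>\<rbrakk> \<Longrightarrow>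
      (x, y) \<in> exch_arcs (maximizers D (h p')) A"
proof -
  define w where "w z = (if z \<in> V then 0 else \<epsilon>)" for z
  have AD: "A \<in> D" "\<And>S. S \<in> D \<Longrightarrow> h p S \<le> h p A" using A by (auto simp: maximizers_def)
  have finD: "finite S" if "S \<in> D" for S using that fin by (auto intro: finite_subset)
  have so: "sum p' (set_option z) = sum p (set_option z) + w z" for z
    using V by (cases z) (auto simp: p'_def w_def)
  \<comment> \<open>Only arcs crossing the boundary of \<open>V\<close> change their slack: it drops
    by the raise for arcs leaving \<open>V\<close> and grows by it for arcs entering. The dummy lies
    in \<open>V\<close>, so its price stays zero.\<close>
  have key: "h p' (swap A x y) - h p' A = h p (swap A x y) - h p A + w y - w x"
    if "set_option x \<subseteq> A" "set_option y \<inter> A = {}" for x y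
    unfolding h sum_swap[OF finD[OF AD(1)] that] so by simp
  show max: "A \<in> maximizers D (h p')"
  proof (rule mnat_local_max[OF _ AD(1) finD[OF AD(1)] finD])
    show "mnat D (h p')" unfolding h by (rule mnat_add_linear[OF D finD])
  next
    fix x y assume xy: "set_option x \<subseteq> A" "set_option y \<inter> A = {}" "swap A x y \<in> D"
    show "h p' (swap A x y) \<le> h p' A"
      using key[OF xy(1,2)] AD(2)[OF xy(3)] slack[of x y] xy eps
      by (cases "x \<in> V"; cases "y \<in> V") (auto simp: w_def frontier_def)
  qed
  have arc: "(x, y) \<in> exch_arcs (maximizers D (h p')) A"
    if "set_option x \<subseteq> A" "set_option y \<inter> A = {}" "swap A x y \<in> D" "h p' (swap A x y) = h p' A" for x y
    using that max by (auto simp: exch_arcs_def maximizers_def)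
  show "(x, y) \<in> exch_arcs (maximizers D (h p')) A"
    if "(x, y) \<in> exch_arcs (maximizers D (h p)) A" "x \<in> V" "y \<in> V" for x y
  proof (rule arc)
    show xy: "set_option x \<subseteq> A" "set_option y \<inter> A = {}" "swap A x y \<in> D"
      using that(1) by (auto simp: exch_arcs_def maximizers_def)
    have "h p A \<le> h p (swap A x y)" using that(1) AD(1) by (auto simp: exch_arcs_def maximizers_def)
    then show "h p' (swap A x y) = h p' A"
      using key[OF xy(1,2)] AD(2)[OF xy(3)] that(2,3) by (simp add: w_def)
  qed
  show "(x, y) \<in> exch_arcs (maximizers D (h p')) A"
    if "(x, y) \<in> frontier V D A" "h p A - h p (swap A x y) = \<epsilon>" for x y
    using key[of x y] that by (intro arc) (auto simp: w_def frontier_def)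
qed

definition reachable :: "('a option \<times> 'a option) set \<Rightarrow> 'a set \<Rightarrow> 'a option set" where
  "reachable R S = R\<^sup>* `` insert None (Some ` S)"

lemma reachable_src: "None \<in> reachable R S" "x \<in> S \<Longrightarrow> Some x \<in> reachable R S"
  by (auto simp: reachable_def)

lemma reachable_step: "x \<in> reachable R S \<Longrightarrow> (x, y) \<in> R \<Longrightarrow> y \<in> reachable R S"
  by (auto simp: reachable_def intro: rtrancl.rtrancl_into_rtrancl)

text \<open>All vertices on a path from a source are reachable, so only arcs inside the reachable
  set have to survive; these are the ones that \<open>price_step\<close> keeps.\<close>

lemma reachable_mono:
  assumes "\<And>x y. (x, y) \<in> R \<Longrightarrow> x \<in> reachable R S \<Longrightarrow> y \<in> reachable R S \<Longrightarrow> (x, y) \<in> R'"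
  shows "reachable R S \<subseteq> reachable R' S"
proof
  fix y assume "y \<in> reachable R S"
  then obtain s where s: "s \<in> insert None (Some ` S)" "(s, y) \<in> R\<^sup>*" by (auto simp: reachable_def)
  from s(2) show "y \<in> reachable R' S"
  proof (induction rule: rtrancl_induct)
    case base
    then show ?case using s(1) by (auto simp: reachable_def)
  next
    case (step y z)
    have "y \<in> reachable R S" using s(1) step(1) by (auto simp: reachable_def)
    then show ?case using step(2,3) assms reachable_step by metis
  qed
qed

text \<open>Here \<open>A\<close> and \<open>B\<close> stay fixed while the price changes, by
  induction on the number of vertices not reachable from the sources. A reachable uncovered element
  permits augmentation; otherwise prices outside the reachable set are raised until it
  grows.\<close>

lemma decrease_defect_uncovered:
  fixes g1 g2 :: "'a set \<Rightarrow> real" and c :: real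
  assumes fin: "finite E" "D1 \<subseteq> Pow E" "D2 \<subseteq> Pow E" and D1: "mnat D1 g1" and D2: "mnat D2 g2"
    and bound: "\<And>p. \<exists>A\<in>D1. \<exists>B\<in>D2. c + sum p E \<le> g1 A + sum p A + (g2 B + sum p B)"
    and ne: "E - (A \<union> B) \<noteq> {}"
  shows "\<lbrakk>A \<in> maximizers D1 (\<lambda>S. g1 S + sum p S); B \<in> maximizers D2 (\<lambda>S. g2 S + sum p S)\<rbrakk> \<Longrightarrow>
    \<exists>p' A' B'. A' \<in> maximizers D1 (\<lambda>S. g1 S + sum p' S) \<and> B' \<in> maximizers D2 (\<lambda>S. g2 S + sum p' S) \<and>
      defect E A' B' < defect E A B"
proof (induction "card (insert None (Some ` E) - reachable
    (exch_arcs (maximizers D1 (\<lambda>S. g1 S + sum p S)) A \<union> exch_arcs (maximizers D2 (\<lambda>S. g2 S + sum p S)) B)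
    (A \<inter> B))" arbitrary: p rule: less_induct)
  case less
  define h1 h2 where "h1 = (\<lambda>p S. g1 S + sum p S)" and "h2 = (\<lambda>p S. g2 S + sum p S)"
  define R where "R p = exch_arcs (maximizers D1 (h1 p)) A \<union> exch_arcs (maximizers D2 (h2 p)) B" for p
  define V where "V = reachable (R p) (A \<inter> B)"
  have A: "A \<in> maximizers D1 (h1 p)" and B: "B \<in> maximizers D2 (h2 p)"
    using less.prems by (simp_all add: h1_def h2_def)
  have AB: "A \<in> D1" "B \<in> D2" "A \<subseteq> E" "B \<subseteq> E" using A B fin by (auto simp: maximizers_def)
  have finD: "\<And>S. S \<in> D1 \<Longrightarrow> finite S" "\<And>S. S \<in> D2 \<Longrightarrow> finite S"
    using fin by (auto intro: finite_subset)
  show ?case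
  proof (cases "V \<inter> Some ` (E - (A \<union> B)) = {}")
    case False
    then obtain x y where x: "x \<in> insert None (Some ` (A \<inter> B))" and y: "y \<in> Some ` (E - (A \<union> B))"
      and "(x, y) \<in> (R p)\<^sup>*" by (auto simp: V_def reachable_def)
    then obtain k where "(x, y) \<in> (R p) ^^ k" by (auto simp: rtrancl_power)
    moreover have "mnat (maximizers D1 (h1 p)) (\<lambda>_. 0)" "mnat (maximizers D2 (h2 p)) (\<lambda>_. 0)"
      unfolding h1_def h2_def
      by (intro mnat_maximizers mnat_add_linear D1 D2 finD; assumption)+
    moreover have "maximizers D1 (h1 p) \<subseteq> Pow E" "maximizers D2 (h2 p) \<subseteq> Pow E"
      using fin by (auto simp: maximizers_def)
    ultimately have "\<exists>A'\<in>maximizers D1 (h1 p). \<exists>B'\<in>maximizers D2 (h2 p). defect E A' B' < defect E A B"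
      using fin(1) A B x y unfolding R_def by (intro augment[where k = k and x = x and y = y])
    then show ?thesis by (auto simp: h1_def h2_def)
  next
    case True
    \<comment> \<open>The slacks of all feasible exchanges leaving \<open>V\<close>. They are
      positive because an exchange without slack is an arc of \<open>R p\<close>, and
      \<open>V\<close> is closed under these arcs.\<close>
    define \<Delta> where "\<Delta> = (\<lambda>(x, y). h1 p A - h1 p (swap A x y)) ` frontier V D1 A \<union>
      (\<lambda>(x, y). h2 p B - h2 p (swap B x y)) ` frontier V D2 B"
    have fin\<Delta>: "finite \<Delta>" unfolding \<Delta>_def using finite_frontier fin AB by blast
    have pos: "0 < d" if "d \<in> \<Delta>" for d
    proof -
      have "h1 p (swap A x y) < h1 p A" if "(x, y) \<in> frontier V D1 A" for x y
      proof (rule ccontr)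
        assume "\<not> ?thesis"
        then have "(x, y) \<in> R p" using that A by (force simp: R_def exch_arcs_def frontier_def maximizers_def)
        then show False using that reachable_step unfolding frontier_def V_def by fast
      qed
      moreover have "h2 p (swap B x y) < h2 p B" if "(x, y) \<in> frontier V D2 B" for x y
      proof (rule ccontr)
        assume "\<not> ?thesis"
        then have "(x, y) \<in> R p" using that B by (force simp: R_def exch_arcs_def frontier_def maximizers_def)
        then show False using that reachable_step unfolding frontier_def V_def by fast
      qed
      ultimately show ?thesis using that by (auto simp: \<Delta>_def)
    qed
    define p' where "p' \<epsilon> = (\<lambda>v. p v + (if Some v \<in> V then 0 else \<epsilon>))" for \<epsilon>
    have N: "None \<in> V" unfolding V_def by (rule reachable_src)
    have ps1: "A \<in> maximizers D1 (h1 (p' \<epsilon>))"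
      "\<And>x y. \<lbrakk>(x, y) \<in> exch_arcs (maximizers D1 (h1 p)) A; x \<in> V; y \<in> V\<rbrakk> \<Longrightarrow>
        (x, y) \<in> exch_arcs (maximizers D1 (h1 (p' \<epsilon>))) A"
      "\<And>x y. \<lbrakk>(x, y) \<in> frontier V D1 A; h1 p A - h1 p (swap A x y) = \<epsilon>\<rbrakk> \<Longrightarrow>
        (x, y) \<in> exch_arcs (maximizers D1 (h1 (p' \<epsilon>))) A"
      if "0 \<le> \<epsilon>" "\<And>d. d \<in> \<Delta> \<Longrightarrow> \<epsilon> \<le> d" for \<epsilon>
    proof -
      have "\<epsilon> \<le> h1 p A - h1 p (swap A x y)" if "(x, y) \<in> frontier V D1 A" for x y
        using that by (intro \<open>\<And>d. d \<in> \<Delta> \<Longrightarrow> \<epsilon> \<le> d\<close>) (force simp: \<Delta>_def)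
      note ps = price_step[OF h1_def fin(1,2) D1 A N that(1) this, folded p'_def]
      show "A \<in> maximizers D1 (h1 (p' \<epsilon>))" by (rule ps(1))
      show "(x, y) \<in> exch_arcs (maximizers D1 (h1 (p' \<epsilon>))) A"
        if "(x, y) \<in> exch_arcs (maximizers D1 (h1 p)) A" "x \<in> V" "y \<in> V" for x y
        by (rule ps(2)) (use that in simp_all)
      show "(x, y) \<in> exch_arcs (maximizers D1 (h1 (p' \<epsilon>))) A"
        if "(x, y) \<in> frontier V D1 A" "h1 p A - h1 p (swap A x y) = \<epsilon>" for x y
        by (rule ps(3)) (use that in simp_all)
    qed
    have ps2: "B \<in> maximizers D2 (h2 (p' \<epsilon>))"
      "\<And>x y. \<lbrakk>(x, y) \<in> exch_arcs (maximizers D2 (h2 p)) B; x \<in> V; y \<in> V\<rbrakk> \<Longrightarrow>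
        (x, y) \<in> exch_arcs (maximizers D2 (h2 (p' \<epsilon>))) B"
      "\<And>x y. \<lbrakk>(x, y) \<in> frontier V D2 B; h2 p B - h2 p (swap B x y) = \<epsilon>\<rbrakk> \<Longrightarrow>
        (x, y) \<in> exch_arcs (maximizers D2 (h2 (p' \<epsilon>))) B"
      if "0 \<le> \<epsilon>" "\<And>d. d \<in> \<Delta> \<Longrightarrow> \<epsilon> \<le> d" for \<epsilon>
    proof -
      have "\<epsilon> \<le> h2 p B - h2 p (swap B x y)" if "(x, y) \<in> frontier V D2 B" for x y
        using that by (intro \<open>\<And>d. d \<in> \<Delta> \<Longrightarrow> \<epsilon> \<le> d\<close>) (force simp: \<Delta>_def)
      note ps = price_step[OF h2_def fin(1,3) D2 B N that(1) this, folded p'_def]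
      show "B \<in> maximizers D2 (h2 (p' \<epsilon>))" by (rule ps(1))
      show "(x, y) \<in> exch_arcs (maximizers D2 (h2 (p' \<epsilon>))) B"
        if "(x, y) \<in> exch_arcs (maximizers D2 (h2 p)) B" "x \<in> V" "y \<in> V" for x y
        by (rule ps(2)) (use that in simp_all)
      show "(x, y) \<in> exch_arcs (maximizers D2 (h2 (p' \<epsilon>))) B"
        if "(x, y) \<in> frontier V D2 B" "h2 p B - h2 p (swap B x y) = \<epsilon>" for x y
        by (rule ps(3)) (use that in simp_all)
    qed
    show ?thesis
    proof (cases "\<Delta> = {}")
      case True': True
      \<comment> \<open>Without exchanges leaving \<open>V\<close>, any raise keeps \<open>A\<close>
        and \<open>B\<close> maximal. But elements of \<open>A \<inter> B\<close> are sources and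
        lie in \<open>V\<close>, so \<open>A\<close> and \<open>B\<close> are disjoint on
        \<open>W\<close> and miss the uncovered elements; a large raise contradicts
        \<open>bound\<close>.\<close>
      define W where "W = {v \<in> E. Some v \<notin> V}"
      have sum_p': "sum (p' \<epsilon>) S = sum p S + \<epsilon> * card (S \<inter> W)" if "S \<subseteq> E" for \<epsilon> S
      proof -
        have "sum (\<lambda>v. if Some v \<in> V then 0 else \<epsilon>) S = sum (\<lambda>v. if v \<in> W then \<epsilon> else 0) S"
          using that by (intro sum.cong) (auto simp: W_def)
        also have "\<dots> = \<epsilon> * card (S \<inter> W)"
          using that fin(1) by (simp add: sum.If_cases finite_subset Int_def)
        finally show ?thesis by (simp add: p'_def sum.distrib)
      qed
      have W: "(A \<inter> W) \<inter> (B \<inter> W) = {}" "E - (A \<union> B) \<subseteq> W" "W \<subseteq> E"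
        using True reachable_src(2)[of _ "A \<inter> B" "R p"] by (auto simp: W_def V_def)
      have "W = (A \<inter> W \<union> B \<inter> W) \<union> (E - (A \<union> B))" using W by auto
      moreover have "finite (A \<inter> W \<union> B \<inter> W)" using fin(1) AB by (auto intro: finite_subset)
      moreover have "(A \<inter> W \<union> B \<inter> W) \<inter> (E - (A \<union> B)) = {}" by blast
      ultimately have "card W = card (A \<inter> W \<union> B \<inter> W) + card (E - (A \<union> B))"
        using fin(1) card_Un_disjoint finite_Diff by metis
      also have "card (A \<inter> W \<union> B \<inter> W) = card (A \<inter> W) + card (B \<inter> W)"
        using fin(1) W AB by (intro card_Un_disjoint) (auto intro: finite_subset)
      finally have cW: "card (A \<inter> W) + card (B \<inter> W) < card (E \<inter> W)"
        using ne fin(1) W(3) by (simp add: card_gt_0_iff inf.absorb2)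
      have le: "c + sum q E \<le> h1 q A + h2 q B"
        if m: "A \<in> maximizers D1 (h1 q)" "B \<in> maximizers D2 (h2 q)" for q
      proof -
        obtain A0 B0 where "A0 \<in> D1" "B0 \<in> D2" "c + sum q E \<le> h1 q A0 + h2 q B0"
          using bound[of q] unfolding h1_def h2_def by blast
        then show ?thesis using m by (fastforce simp: maximizers_def)
      qed
      \<comment> \<open>One more than the current gap in the bound: each unit of the raise costs the
        gap at least one.\<close>
      define \<epsilon> where "\<epsilon> = h1 p A + h2 p B - (c + sum p E) + 1"
      have "\<epsilon> \<ge> 1" using le[OF A B] by (simp add: \<epsilon>_def)
      then have "c + sum (p' \<epsilon>) E \<le> h1 (p' \<epsilon>) A + h2 (p' \<epsilon>) B"
        using ps1(1)[of \<epsilon>] ps2(1)[of \<epsilon>] True' by (intro le) auto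
      then have "\<epsilon> * real (card (E \<inter> W)) \<le> \<epsilon> - 1 + \<epsilon> * real (card (A \<inter> W) + card (B \<inter> W))"
        using sum_p' AB unfolding h1_def h2_def \<epsilon>_def by (simp add: algebra_simps)
      moreover have "\<epsilon> * real (card (A \<inter> W) + card (B \<inter> W) + 1) \<le> \<epsilon> * real (card (E \<inter> W))"
        using cW \<open>\<epsilon> \<ge> 1\<close> by (intro mult_left_mono) linarith+
      ultimately show ?thesis by (simp add: algebra_simps)
    next
      case False
      define \<epsilon> where "\<epsilon> = Min \<Delta>"
      have e: "\<epsilon> \<in> \<Delta>" "\<And>d. d \<in> \<Delta> \<Longrightarrow> \<epsilon> \<le> d" using False fin\<Delta> by (auto simp: \<epsilon>_def)
      have e0: "0 \<le> \<epsilon>" using pos[OF e(1)] by simp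
      note ps1 = ps1[OF e0 e(2)] and ps2 = ps2[OF e0 e(2)]
      let ?V = "reachable (R (p' \<epsilon>)) (A \<inter> B)"
      have sub: "V \<subseteq> ?V"
        unfolding V_def
        by (rule reachable_mono) (use ps1(2) ps2(2) in \<open>auto simp: R_def V_def\<close>)
      obtain x y where xy: "(x, y) \<in> frontier V D1 A \<union> frontier V D2 B" "(x, y) \<in> R (p' \<epsilon>)"
      proof -
        from e(1) consider x y where "(x, y) \<in> frontier V D1 A" "h1 p A - h1 p (swap A x y) = \<epsilon>"
          | x y where "(x, y) \<in> frontier V D2 B" "h2 p B - h2 p (swap B x y) = \<epsilon>"
          unfolding \<Delta>_def by auto
        then show ?thesis using that ps1(3) ps2(3) unfolding R_def by cases blast+
      qed
      have "x \<in> V" "y \<notin> V" using xy(1) by (auto simp: frontier_def)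
      then have "y \<in> ?V" using sub xy(2) reachable_step by blast
      moreover have "y \<in> insert None (Some ` E)"
      proof -
        have "set_option y \<subseteq> E" using xy(1) fin by (auto simp: frontier_def swap_def)
        then show ?thesis by (cases y) auto
      qed
      ultimately have "insert None (Some ` E) - ?V \<subset> insert None (Some ` E) - V"
        using sub \<open>y \<notin> V\<close> by blast
      then have "card (insert None (Some ` E) - ?V) < card (insert None (Some ` E) - V)"
        using fin(1) by (intro psubset_card_mono) auto
      then show ?thesis
        using less.hyps[of "p' \<epsilon>"] ps1(1) ps2(1)
        unfolding V_def R_def h1_def h2_def by blast
    qed
  qed
qed

section \<open>Complementation and the partition theorem\<close>

text \<open>Complementing reverses set differences, so the exchange is applied to the complements in
  swapped roles.\<close>

lemma mnat_complement:
  assumes "mnat D g" "D \<subseteq> Pow E"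
  shows "mnat ((\<lambda>S. E - S) ` D) (\<lambda>S. g (E - S))"
  unfolding mnat_def
proof (intro ballI)
  fix X Y i assume "X \<in> (\<lambda>S. E - S) ` D" "Y \<in> (\<lambda>S. E - S) ` D" and i: "i \<in> X - Y"
  then have X: "E - X \<in> D" "X \<subseteq> E" and Y: "E - Y \<in> D" "Y \<subseteq> E"
    using assms(2) by (auto simp: double_diff)
  have "i \<in> (E - Y) - (E - X)" using i X by auto
  then obtain e where e: "set_option e \<subseteq> (E - X) - (E - Y)" "swap (E - Y) (Some i) e \<in> D"
    "swap (E - X) e (Some i) \<in> D"
    "g (E - Y) + g (E - X) \<le> g (swap (E - Y) (Some i) e) + g (swap (E - X) e (Some i))"
    using mnatD[OF assms(1) Y(1) X(1)] by blast
  have eY: "set_option e \<subseteq> Y - X" using e(1) by auto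
  have "swap (E - Y) (Some i) e = E - swap Y e (Some i)" "swap (E - X) e (Some i) = E - swap X (Some i) e"
    using eY i X Y by (auto simp: swap_def)
  moreover have "swap X (Some i) e \<subseteq> E" "swap Y e (Some i) \<subseteq> E"
    using eY i X Y by (auto simp: swap_def)
  then have "E - (E - swap X (Some i) e) = swap X (Some i) e"
    "E - (E - swap Y e (Some i)) = swap Y e (Some i)" by (auto simp: double_diff)
  ultimately show "\<exists>e. set_option e \<subseteq> Y - X \<and> swap X (Some i) e \<in> (\<lambda>S. E - S) ` D \<and>
      swap Y e (Some i) \<in> (\<lambda>S. E - S) ` D \<and>
      g (E - X) + g (E - Y) \<le> g (E - swap X (Some i) e) + g (E - swap Y e (Some i))"
    using e eY by (metis add.commute imageI)
qed

lemma maximizers_complement: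
  fixes p :: "'a \<Rightarrow> real"
  assumes "finite E" "D \<subseteq> Pow E" "A \<in> maximizers D (\<lambda>S. g S + sum p S)"
  shows "E - A \<in> maximizers ((\<lambda>S. E - S) ` D) (\<lambda>S. g (E - S) + sum (\<lambda>v. - p v) S)"
proof -
  have "sum (\<lambda>v. - p v) (E - S) = sum p S - sum p E" "E - (E - S) = S" if "S \<in> D" for S
    using that assms(1,2) by (auto simp: sum_negf sum_diff)
  then show ?thesis using assms(2,3) by (auto simp: maximizers_def)
qed

lemma maximizers_cong:
  assumes "\<And>S. S \<in> D \<Longrightarrow> h S = h' S"
  shows "maximizers D h = maximizers D h'"
proof -
  have "(\<forall>S\<in>D. h S \<le> h A) \<longleftrightarrow> (\<forall>S\<in>D. h' S \<le> h' A)" if "A \<in> D" for A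
    by (rule ball_cong) (use assms that in simp_all)
  then show ?thesis unfolding maximizers_def by blast
qed

text \<open>If every element is covered, a positive defect comes from doubly covered ones.
  Complementing both sets within \<open>E\<close> makes these uncovered, preserves the defect and
  negates the prices.\<close>

lemma decrease_defect:
  fixes g1 g2 :: "'a set \<Rightarrow> real" and c :: real
  assumes fin: "finite E" "D1 \<subseteq> Pow E" "D2 \<subseteq> Pow E" and D1: "mnat D1 g1" and D2: "mnat D2 g2"
    and bound: "\<And>p. \<exists>A\<in>D1. \<exists>B\<in>D2. c + sum p E \<le> g1 A + sum p A + (g2 B + sum p B)"
    and A: "A \<in> maximizers D1 (\<lambda>S. g1 S + sum p S)" and B: "B \<in> maximizers D2 (\<lambda>S. g2 S + sum p S)"
    and pos: "defect E A B \<noteq> 0"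
  shows "\<exists>p' A' B'. A' \<in> maximizers D1 (\<lambda>S. g1 S + sum p' S) \<and> B' \<in> maximizers D2 (\<lambda>S. g2 S + sum p' S) \<and>
      defect E A' B' < defect E A B"
proof (cases "E - (A \<union> B) = {}")
  case False
  then show ?thesis using decrease_defect_uncovered[OF fin D1 D2 bound _ A B] by blast
next
  case True
  let ?c = "\<lambda>S. E - S"
  have inv: "?c ` ?c ` D = D" if "D \<subseteq> Pow E" for D
    using that by (force simp: image_image double_diff intro: rev_image_eqI)
  have def: "defect E (?c A) (?c B) = defect E A B" if "A \<subseteq> E" "B \<subseteq> E" for A B
  proof -
    have "?c A \<inter> ?c B = E - (A \<union> B)" "E - (?c A \<union> ?c B) = A \<inter> B" using that by auto
    then show ?thesis by (simp add: defect_def)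
  qed
  have sub: "A \<subseteq> E" "B \<subseteq> E" using A B fin by (auto simp: maximizers_def)
  then have "E - (?c A \<union> ?c B) = A \<inter> B" by auto
  moreover have "A \<inter> B \<noteq> {}" using pos True by (auto simp: defect_def)
  ultimately have ne: "E - (?c A \<union> ?c B) \<noteq> {}" by simp
  \<comment> \<open>This is the bound for the negated prices with twice \<open>sum p E\<close> added
    to both sides.\<close>
  have bound': "\<exists>A\<in>?c ` D1. \<exists>B\<in>?c ` D2. c + sum p E \<le> g1 (?c A) + sum p A + (g2 (?c B) + sum p B)" for p
  proof -
    obtain A B where AB: "A \<in> D1" "B \<in> D2"
      "c + sum (\<lambda>v. - p v) E \<le> g1 A + sum (\<lambda>v. - p v) A + (g2 B + sum (\<lambda>v. - p v) B)"
      using bound by blast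
    have "A \<subseteq> E" "B \<subseteq> E" using AB fin by auto
    then have "?c (?c A) = A" "?c (?c B) = B" "sum p (?c A) = sum p E - sum p A"
      "sum p (?c B) = sum p E - sum p B" using fin(1) by (auto simp: sum_diff)
    then have "c + sum p E \<le> g1 (?c (?c A)) + sum p (?c A) + (g2 (?c (?c B)) + sum p (?c B))"
      using AB(3) by (simp add: sum_negf)
    then show ?thesis using AB(1,2) by blast
  qed
  have "\<exists>p' A' B'. A' \<in> maximizers (?c ` D1) (\<lambda>S. g1 (?c S) + sum p' S) \<and>
      B' \<in> maximizers (?c ` D2) (\<lambda>S. g2 (?c S) + sum p' S) \<and> defect E A' B' < defect E (?c A) (?c B)"
    using fin(1)
    by (rule decrease_defect_uncovered[OF _ _ _ mnat_complement[OF D1 fin(2)] mnat_complement[OF D2 fin(3)] bound' ne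
        maximizers_complement[OF fin(1,2) A] maximizers_complement[OF fin(1,3) B]]) auto
  then obtain p' A' B' where A': "A' \<in> maximizers (?c ` D1) (\<lambda>S. g1 (?c S) + sum p' S)"
    and B': "B' \<in> maximizers (?c ` D2) (\<lambda>S. g2 (?c S) + sum p' S)"
    and less: "defect E A' B' < defect E A B" using def[OF sub] by auto
  have dd: "g (?c (?c S)) = g S" if "S \<in> D" "D \<subseteq> Pow E" for S D and g :: "'a set \<Rightarrow> real"
    using that by (auto simp: double_diff)
  have mc: "maximizers D (\<lambda>S. g (?c (?c S)) + sum q S) = maximizers D (\<lambda>S. g S + sum q S)"
    if "D \<subseteq> Pow E" for D q and g :: "'a set \<Rightarrow> real"
    by (rule maximizers_cong) (simp add: dd[OF _ that])
  have "?c A' \<in> maximizers D1 (\<lambda>S. g1 S + sum (\<lambda>v. - p' v) S)"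
    using maximizers_complement[OF fin(1) _ A'] unfolding inv[OF fin(2)] mc[OF fin(2)] by blast
  moreover have "?c B' \<in> maximizers D2 (\<lambda>S. g2 S + sum (\<lambda>v. - p' v) S)"
    using maximizers_complement[OF fin(1) _ B'] unfolding inv[OF fin(3)] mc[OF fin(3)] by blast
  moreover have "A' \<subseteq> E" "B' \<subseteq> E" using A' B' by (auto simp: maximizers_def)
  ultimately show ?thesis using less def by metis
qed

text \<open>From any maximizers, at any price, the defect is lowered to zero. For the resulting
  partition the price terms sum to \<open>sum p E\<close> and cancel in the bound.\<close>

lemma mnat_partition:
  fixes g1 g2 :: "'a set \<Rightarrow> real" and c :: real
  assumes fin: "finite E" "D1 \<subseteq> Pow E" "D2 \<subseteq> Pow E" and D1: "mnat D1 g1" and D2: "mnat D2 g2"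
    and bound: "\<And>p. \<exists>A\<in>D1. \<exists>B\<in>D2. c + sum p E \<le> g1 A + sum p A + (g2 B + sum p B)"
  shows "\<exists>J\<subseteq>E. J \<in> D1 \<and> E - J \<in> D2 \<and> c \<le> g1 J + g2 (E - J)"
proof -
  have ex: "\<exists>A. A \<in> maximizers D h" if D: "finite D" "D \<noteq> {}" for D and h :: "'a set \<Rightarrow> real"
  proof -
    obtain m where "m \<in> D" "\<And>x. x \<in> D \<Longrightarrow> h x \<le> h m" using ex_max_on_finite[OF D, of h] by blast
    then show ?thesis unfolding maximizers_def by blast
  qed
  have "finite D1" "finite D2" "D1 \<noteq> {}" "D2 \<noteq> {}"
    using fin bound by (auto intro: finite_subset)
  then obtain p A B where "A \<in> maximizers D1 (\<lambda>S. g1 S + sum p S)"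
    "B \<in> maximizers D2 (\<lambda>S. g2 S + sum p S)" using ex by meson
  then have "\<exists>p A B. A \<in> maximizers D1 (\<lambda>S. g1 S + sum p S) \<and> B \<in> maximizers D2 (\<lambda>S. g2 S + sum p S) \<and>
      defect E A B = 0"
  proof (induction "defect E A B" arbitrary: A B p rule: less_induct)
    case less
    show ?case
    proof (cases "defect E A B = 0")
      case False
      from decrease_defect[OF fin D1 D2 bound less.prems False] show ?thesis
        using less.hyps by blast
    qed (use less.prems in blast)
  qed
  then obtain p A B where A: "A \<in> maximizers D1 (\<lambda>S. g1 S + sum p S)"
    and B: "B \<in> maximizers D2 (\<lambda>S. g2 S + sum p S)" and 0: "defect E A B = 0" by blast
  have AB: "A \<in> D1" "B \<in> D2" "A \<subseteq> E" "B \<subseteq> E" using A B fin by (auto simp: maximizers_def)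
  then have "finite (A \<inter> B)" "finite (E - (A \<union> B))" using fin(1) by (auto intro: finite_subset)
  then have "A \<inter> B = {}" "E - (A \<union> B) = {}" using 0 by (auto simp: defect_def)
  then have BE: "B = E - A" using AB by auto
  obtain A0 B0 where "A0 \<in> D1" "B0 \<in> D2" "c + sum p E \<le> g1 A0 + sum p A0 + (g2 B0 + sum p B0)"
    using bound by blast
  moreover from this have "g1 A0 + sum p A0 \<le> g1 A + sum p A" "g2 B0 + sum p B0 \<le> g2 B + sum p B"
    using A B by (auto simp: maximizers_def)
  moreover have "sum p B = sum p E - sum p A" unfolding BE using AB(3) fin(1) by (simp add: sum_diff)
  ultimately show ?thesis using AB BE by (intro exI[of _ A]) auto
qed

section \<open>Exchange implies multiple exchange\<close>

text \<open>For a single element the partner \<open>e\<close> lies outside \<open>Q\<close>, since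
  \<open>Y\<close> has no element of \<open>Q\<close> that \<open>X\<close> lacks; so the traces on
  \<open>Q\<close> change by exactly that element. Induction on \<open>I\<close> adds up such
  steps.\<close>

lemma mnat_projection_submodular:
  assumes D: "mnat D h" and fin: "finite D"
  shows "\<lbrakk>finite I; X \<in> D; Y \<in> D; Y \<inter> Q \<subseteq> X \<inter> Q; I \<subseteq> (X - Y) \<inter> Q\<rbrakk> \<Longrightarrow>
    \<exists>X'\<in>D. \<exists>Y'\<in>D. X' \<inter> Q = X \<inter> Q - I \<and> Y' \<inter> Q = Y \<inter> Q \<union> I \<and> h X + h Y \<le> h X' + h Y'"
proof (induction I arbitrary: X Y rule: finite_induct)
  case empty
  then show ?case by auto
next
  case (insert i I)
  have step: "\<exists>X'\<in>D. \<exists>Y'\<in>D. X' \<inter> Q = X \<inter> Q - {i} \<and> Y' \<inter> Q = Y \<inter> Q \<union> {i} \<and> h X + h Y \<le> h X' + h Y'"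
    if XY: "X \<in> D" "Y \<in> D" "Y \<inter> Q \<subseteq> X \<inter> Q" "i \<in> X - Y" "i \<in> Q" for X Y
  proof -
    obtain e where e: "set_option e \<subseteq> Y - X" "swap X (Some i) e \<in> D" "swap Y e (Some i) \<in> D"
      "h X + h Y \<le> h (swap X (Some i) e) + h (swap Y e (Some i))"
      using mnatD[OF D XY(1,2,4)] .
    have "set_option e \<inter> Q = {}" using e(1) XY(3) by auto
    then have "swap X (Some i) e \<inter> Q = X \<inter> Q - {i}" "swap Y e (Some i) \<inter> Q = Y \<inter> Q \<union> {i}"
      using XY(5) by (auto simp: swap_def)
    then show ?thesis using e by blast
  qed
  have i: "i \<in> X - Y" "i \<in> Q" using insert.prems by auto
  \<comment> \<open>The best set with the trace of the one-element step is used in the induction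
    hypothesis. Its value dominates that of \<open>X3\<close>, which has the same trace, and so both
    cancel when the two inequalities are added.\<close>
  let ?S = "{S \<in> D. S \<inter> Q = X \<inter> Q - {i}}"
  have "?S \<noteq> {}" using step[OF insert.prems(1-3) i] by blast
  then obtain X1 where X1: "X1 \<in> ?S" "\<And>S. S \<in> ?S \<Longrightarrow> h S \<le> h X1"
    using ex_max_on_finite[of ?S h] fin by auto
  have X1': "X1 \<in> D" "X1 \<inter> Q = X \<inter> Q - {i}" using X1(1) by auto
  have "I \<subseteq> (X1 - Y) \<inter> Q" "Y \<inter> Q \<subseteq> X1 \<inter> Q" using X1' insert.prems insert.hyps by auto
  then obtain X2 Y2 where 2: "X2 \<in> D" "Y2 \<in> D" "X2 \<inter> Q = X1 \<inter> Q - I" "Y2 \<inter> Q = Y \<inter> Q \<union> I"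
    "h X1 + h Y \<le> h X2 + h Y2" using insert.IH[OF X1'(1) insert.prems(2)] by blast
  have "Y2 \<inter> Q \<subseteq> X \<inter> Q" "i \<in> X - Y2" using 2(4) insert.prems insert.hyps i by auto
  then obtain X3 Y3 where 3: "X3 \<in> D" "Y3 \<in> D" "X3 \<inter> Q = X \<inter> Q - {i}" "Y3 \<inter> Q = Y2 \<inter> Q \<union> {i}"
    "h X + h Y2 \<le> h X3 + h Y3" using step[OF insert.prems(1) 2(2) _ _ i(2)] by blast
  have "h X + h Y \<le> h X2 + h Y3" using X1(2)[of X3] 2(5) 3 by auto
  moreover have "X2 \<inter> Q = X \<inter> Q - insert i I" "Y3 \<inter> Q = Y \<inter> Q \<union> insert i I"
    using 2 3 X1' by auto
  ultimately show ?case using 2(1) 3(2) by blast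
qed

lemma mnat_slice:
  assumes "mnat D g" "K \<inter> E = {}"
  shows "mnat {J. J \<subseteq> E \<and> K \<union> J \<in> D} (\<lambda>J. g (K \<union> J))"
  unfolding mnat_def
proof (intro ballI)
  fix X Y i assume "X \<in> {J. J \<subseteq> E \<and> K \<union> J \<in> D}" "Y \<in> {J. J \<subseteq> E \<and> K \<union> J \<in> D}" and i: "i \<in> X - Y"
  then have XY: "X \<subseteq> E" "Y \<subseteq> E" "K \<union> X \<in> D" "K \<union> Y \<in> D" by auto
  have "i \<in> (K \<union> X) - (K \<union> Y)" using i XY assms(2) by auto
  then obtain e where e: "set_option e \<subseteq> (K \<union> Y) - (K \<union> X)" "swap (K \<union> X) (Some i) e \<in> D"
    "swap (K \<union> Y) e (Some i) \<in> D"
    "g (K \<union> X) + g (K \<union> Y) \<le> g (swap (K \<union> X) (Some i) e) + g (swap (K \<union> Y) e (Some i))"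
    using mnatD[OF assms(1) XY(3,4)] by blast
  have "set_option e \<subseteq> Y - X" using e(1) by auto
  moreover have "swap (K \<union> X) (Some i) e = K \<union> swap X (Some i) e"
    "swap (K \<union> Y) e (Some i) = K \<union> swap Y e (Some i)"
    using e(1) XY i assms(2) by (auto simp: swap_def)
  moreover have "swap X (Some i) e \<subseteq> E" "swap Y e (Some i) \<subseteq> E"
    using e(1) XY i by (auto simp: swap_def)
  ultimately show "\<exists>e. set_option e \<subseteq> Y - X \<and> swap X (Some i) e \<in> {J. J \<subseteq> E \<and> K \<union> J \<in> D} \<and>
      swap Y e (Some i) \<in> {J. J \<subseteq> E \<and> K \<union> J \<in> D} \<and>
      g (K \<union> X) + g (K \<union> Y) \<le> g (K \<union> swap X (Some i) e) + g (K \<union> swap Y e (Some i))"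
    using e by auto
qed

lemma mnat_interval:
  assumes "mnat D g"
  shows "mnat {S \<in> D. Z \<subseteq> S \<and> S \<subseteq> W} g"
  unfolding mnat_def
proof (intro ballI)
  fix X Y i assume "X \<in> {S \<in> D. Z \<subseteq> S \<and> S \<subseteq> W}" "Y \<in> {S \<in> D. Z \<subseteq> S \<and> S \<subseteq> W}" and i: "i \<in> X - Y"
  then have XY: "X \<in> D" "Y \<in> D" "Z \<subseteq> X" "Z \<subseteq> Y" "X \<subseteq> W" "Y \<subseteq> W" by auto
  obtain e where e: "set_option e \<subseteq> Y - X" "swap X (Some i) e \<in> D" "swap Y e (Some i) \<in> D"
    "g X + g Y \<le> g (swap X (Some i) e) + g (swap Y e (Some i))"
    using mnatD[OF assms XY(1,2) i] .
  have "Z \<subseteq> swap X (Some i) e" "Z \<subseteq> swap Y e (Some i)" "swap X (Some i) e \<subseteq> W" "swap Y e (Some i) \<subseteq> W"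
    using e(1) XY i by (auto simp: swap_def)
  then show "\<exists>e. set_option e \<subseteq> Y - X \<and> swap X (Some i) e \<in> {S \<in> D. Z \<subseteq> S \<and> S \<subseteq> W} \<and>
      swap Y e (Some i) \<in> {S \<in> D. Z \<subseteq> S \<and> S \<subseteq> W} \<and>
      g X + g Y \<le> g (swap X (Some i) e) + g (swap Y e (Some i))"
    using e by auto
qed

lemma mnat_imp_mexch:
  assumes D: "mnat D g" and fin: "finite N" "D \<subseteq> Pow N"
  shows "mexch D g"
  unfolding mexch_def
proof (intro ballI allI impI)
  fix X Y I assume X: "X \<in> D" and Y: "Y \<in> D" and I: "I \<subseteq> X - Y"
  define P E Z where "P = X - Y" and "E = Y - X" and "Z = X \<inter> Y"
  have finXY: "finite X" "finite Y" using X Y fin by (auto intro: finite_subset)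
  define K1 K2 where "K1 = X - I" and "K2 = Z \<union> I"
  define D1 D2 where "D1 = {J. J \<subseteq> E \<and> K1 \<union> J \<in> D}" and "D2 = {J. J \<subseteq> E \<and> K2 \<union> J \<in> D}"
  have K: "K1 \<inter> E = {}" "K2 \<inter> E = {}" using I by (auto simp: K1_def K2_def E_def Z_def)
  have "\<exists>J\<subseteq>E. J \<in> D1 \<and> E - J \<in> D2 \<and> g X + g Y \<le> g (K1 \<union> J) + g (K2 \<union> (E - J))"
  proof (rule mnat_partition)
    show "finite E" using finXY by (simp add: E_def)
    show "D1 \<subseteq> Pow E" "D2 \<subseteq> Pow E" by (auto simp: D1_def D2_def)
    show "mnat D1 (\<lambda>J. g (K1 \<union> J))" "mnat D2 (\<lambda>J. g (K2 \<union> J))"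
      unfolding D1_def D2_def by (intro mnat_slice D K)+
    fix p :: "'a \<Rightarrow> real"
    \<comment> \<open>The price is extended by zero outside \<open>E\<close>, so it vanishes on
      \<open>X\<close> and contributes exactly \<open>sum p E\<close> on \<open>Y\<close>.\<close>
    define q where "q v = (if v \<in> E then p v else 0)" for v
    have sum_q: "sum q S = sum p (S \<inter> E)" if "finite S" for S
      unfolding q_def using that by (simp add: sum.inter_restrict)
    \<comment> \<open>Between \<open>X \<inter> Y\<close> and \<open>X \<union> Y\<close> a set is
      determined by its traces on \<open>P\<close> and \<open>E\<close>; fixing the trace on
      \<open>P\<close> gives the forms with \<open>K1\<close> and \<open>K2\<close>.\<close>
    define D' where "D' = {S \<in> D. Z \<subseteq> S \<and> S \<subseteq> X \<union> Y}"
    have finD: "finite S" if "S \<in> D" for S using that fin by (auto intro: finite_subset)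
    have "mnat D' (\<lambda>S. g S + sum q S)"
      unfolding D'_def by (rule mnat_interval[OF mnat_add_linear[OF D finD]])
    moreover have "finite D'" using fin by (auto simp: D'_def intro: finite_subset)
    moreover have "finite I" using I finXY by (auto intro: finite_subset)
    moreover have "X \<in> D'" "Y \<in> D'" using X Y by (auto simp: D'_def Z_def)
    moreover have "Y \<inter> P \<subseteq> X \<inter> P" "I \<subseteq> (X - Y) \<inter> P" using I by (auto simp: P_def)
    ultimately have "\<exists>X'\<in>D'. \<exists>Y'\<in>D'. X' \<inter> P = X \<inter> P - I \<and> Y' \<inter> P = Y \<inter> P \<union> I \<and>
        g X + sum q X + (g Y + sum q Y) \<le> g X' + sum q X' + (g Y' + sum q Y')"
      by (rule mnat_projection_submodular)
    then obtain X' Y' where X': "X' \<in> D'" and Y': "Y' \<in> D'" and int: "X' \<inter> P = X \<inter> P - I" "Y' \<inter> P = Y \<inter> P \<union> I"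
      and le: "g X + sum q X + (g Y + sum q Y) \<le> g X' + sum q X' + (g Y' + sum q Y')"
      by blast
    have eq: "X' = K1 \<union> (X' \<inter> E)" "Y' = K2 \<union> (Y' \<inter> E)"
      using X' Y' int I unfolding D'_def K1_def K2_def E_def P_def Z_def by blast+
    have "X' \<inter> E \<in> D1" "Y' \<inter> E \<in> D2"
      using eq X' Y' by (auto simp: D1_def D2_def D'_def)
    moreover have "X \<inter> E = {}" "Y \<inter> E = E" by (auto simp: E_def)
    then have "sum q X = 0" "sum q Y = sum p E" "sum q X' = sum p (X' \<inter> E)" "sum q Y' = sum p (Y' \<inter> E)"
      using sum_q finXY finD X' Y' by (auto simp: D'_def)
    ultimately show "\<exists>A\<in>D1. \<exists>B\<in>D2. g X + g Y + sum p E \<le> g (K1 \<union> A) + sum p A + (g (K2 \<union> B) + sum p B)"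
      using le eq by (intro bexI[of _ "X' \<inter> E"] bexI[of _ "Y' \<inter> E"]) auto
  qed
  then obtain J where J: "J \<subseteq> E" "K1 \<union> J \<in> D" "K2 \<union> (E - J) \<in> D"
    "g X + g Y \<le> g (K1 \<union> J) + g (K2 \<union> (E - J))" by (auto simp: D1_def D2_def)
  have "K2 \<union> (E - J) = (Y - J) \<union> I" using J(1) by (auto simp: K2_def E_def Z_def)
  then show "\<exists>J\<subseteq>Y - X. (X - I) \<union> J \<in> D \<and> (Y - J) \<union> I \<in> D \<and>
      g X + g Y \<le> g ((X - I) \<union> J) + g ((Y - J) \<union> I)"
    using J by (auto simp: K1_def E_def)
qed

section \<open>Translation to extended real values\<close>

text \<open>The lower bound on \<open>a\<close> takes care of the empty set, whose supremum is minus
  infinity.\<close>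

lemma le_Sup_image_iff_ex:
  fixes h :: "'b \<Rightarrow> ereal"
  assumes "finite S" "-\<infinity> < a"
  shows "a \<le> Sup (h ` S) \<longleftrightarrow> (\<exists>j\<in>S. a \<le> h j)"
proof (cases "S = {}")
  case True
  then show ?thesis using assms(2) by (simp add: bot_ereal_def)
next
  case False
  then have "Sup (h ` S) = Max (h ` S)" using assms(1) by (simp add: Max_Sup)
  then show ?thesis using False assms(1) by (simp add: Max_ge_iff)
qed

text \<open>The left-hand side is finite and plus infinity is excluded, so the inequality forces
  both values on the right to be finite.\<close>

lemma dom_f_add_le_iff:
  assumes "\<forall>X\<subseteq>N. f X \<noteq> \<infinity>" "X \<in> dom_f N f" "Y \<in> dom_f N f" "X' \<subseteq> N" "Y' \<subseteq> N"
  shows "f X + f Y \<le> f X' + f Y' \<longleftrightarrow> X' \<in> dom_f N f \<and> Y' \<in> dom_f N f \<and>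
    real_of_ereal (f X) + real_of_ereal (f Y) \<le> real_of_ereal (f X') + real_of_ereal (f Y')"
proof -
  have "f X \<noteq> \<infinity>" "f Y \<noteq> \<infinity>" "f X' \<noteq> \<infinity>" "f Y' \<noteq> \<infinity>" using assms by (auto simp: dom_f_def)
  then show ?thesis using assms(2-)
    by (cases "f X"; cases "f Y"; cases "f X'"; cases "f Y'") (auto simp: dom_f_def)
qed

text \<open>Excluding plus infinity matters here: in \<open>ereal\<close> the sum of plus and minus
  infinity is plus infinity.\<close>

lemma not_dom_f_add_le:
  assumes "\<forall>X\<subseteq>N. f X \<noteq> \<infinity>" "X \<subseteq> N" "Y \<subseteq> N" "X \<notin> dom_f N f \<or> Y \<notin> dom_f N f"
  shows "f X + f Y \<le> a"
proof -
  have "f X = -\<infinity> \<or> f Y = -\<infinity>" "f X \<noteq> \<infinity>" "f Y \<noteq> \<infinity>" using assms by (auto simp: dom_f_def)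
  then show ?thesis by (cases "f X"; cases "f Y") auto
qed

lemma M_nat_concave_iff_mnat:
  assumes "finite N" and inf: "\<forall>X\<subseteq>N. f X \<noteq> \<infinity>" and "dom_f N f \<noteq> {}"
  shows "M_nat_concave N f \<longleftrightarrow> mnat (dom_f N f) (\<lambda>S. real_of_ereal (f S))"
proof -
  have ex: "f X + f Y \<le> max (f (X - {i}) + f (insert i Y))
        (Sup ((\<lambda>j. f (insert j (X - {i})) + f (insert i Y - {j})) ` (Y - X))) \<longleftrightarrow>
      (\<exists>e. set_option e \<subseteq> Y - X \<and> swap X (Some i) e \<in> dom_f N f \<and> swap Y e (Some i) \<in> dom_f N f \<and>
        real_of_ereal (f X) + real_of_ereal (f Y) \<le>
          real_of_ereal (f (swap X (Some i) e)) + real_of_ereal (f (swap Y e (Some i))))"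
    if XY: "X \<in> dom_f N f" "Y \<in> dom_f N f" "i \<in> X - Y" for X Y i
  proof -
    have sub: "X \<subseteq> N" "Y \<subseteq> N" using XY by (auto simp: dom_f_def)
    have "f X + f Y > -\<infinity>" using XY(1,2) by (cases "f X"; cases "f Y") (auto simp: dom_f_def)
    moreover have "finite (Y - X)" using sub assms(1) by (auto intro: finite_subset)
    ultimately have "f X + f Y \<le> max (f (X - {i}) + f (insert i Y))
          (Sup ((\<lambda>j. f (insert j (X - {i})) + f (insert i Y - {j})) ` (Y - X))) \<longleftrightarrow>
        f X + f Y \<le> f (X - {i}) + f (insert i Y) \<or>
        (\<exists>j\<in>Y - X. f X + f Y \<le> f (insert j (X - {i})) + f (insert i Y - {j}))"
      by (simp add: le_max_iff_disj le_Sup_image_iff_ex)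
    also have "\<dots> \<longleftrightarrow> (\<exists>e. set_option e \<subseteq> Y - X \<and>
        f X + f Y \<le> f (swap X (Some i) e) + f (swap Y e (Some i)))"
    proof -
      have "swap X (Some i) (Some j) = insert j (X - {i})" "swap Y (Some j) (Some i) = insert i Y - {j}"
        if "j \<in> Y - X" for j
        using that XY(3) by (auto simp: swap_def)
      moreover have "swap X (Some i) None = X - {i}" "swap Y None (Some i) = insert i Y"
        by (auto simp: swap_def)
      ultimately show ?thesis by (auto simp: split_option_ex)
    qed
    also have "\<dots> \<longleftrightarrow> (\<exists>e. set_option e \<subseteq> Y - X \<and> swap X (Some i) e \<in> dom_f N f \<and>
        swap Y e (Some i) \<in> dom_f N f \<and> real_of_ereal (f X) + real_of_ereal (f Y) \<le>
          real_of_ereal (f (swap X (Some i) e)) + real_of_ereal (f (swap Y e (Some i))))"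
    proof (rule ex_cong1, rule conj_cong[OF refl])
      fix e assume "set_option e \<subseteq> Y - X"
      then have "swap X (Some i) e \<subseteq> N" "swap Y e (Some i) \<subseteq> N" using sub XY(3) by (auto simp: swap_def)
      then show "f X + f Y \<le> f (swap X (Some i) e) + f (swap Y e (Some i)) \<longleftrightarrow>
        swap X (Some i) e \<in> dom_f N f \<and> swap Y e (Some i) \<in> dom_f N f \<and>
        real_of_ereal (f X) + real_of_ereal (f Y) \<le>
          real_of_ereal (f (swap X (Some i) e)) + real_of_ereal (f (swap Y e (Some i)))"
        by (rule dom_f_add_le_iff[OF inf XY(1,2)])
    qed
    finally show ?thesis .
  qed
  show ?thesis
  proof
    assume "M_nat_concave N f"
    then show "mnat (dom_f N f) (\<lambda>S. real_of_ereal (f S))"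
      using ex unfolding mnat_def M_nat_concave_def by (auto simp: dom_f_def)
  next
    assume m: "mnat (dom_f N f) (\<lambda>S. real_of_ereal (f S))"
    show "M_nat_concave N f"
      unfolding M_nat_concave_def valuated_on_def
    proof (intro conjI allI impI)
      fix X Y i assume XY: "X \<subseteq> N" "Y \<subseteq> N" "i \<in> X - Y"
      show "f X + f Y \<le> max (f (X - {i}) + f (insert i Y))
          (Sup ((\<lambda>j. f (insert j (X - {i})) + f (insert i Y - {j})) ` (Y - X)))"
      proof (cases "X \<in> dom_f N f \<and> Y \<in> dom_f N f")
        case True
        then show ?thesis
          using m[unfolded mnat_def, THEN bspec, THEN bspec, THEN bspec, OF _ _ XY(3)]
          by (intro iffD2[OF ex] XY(3)) simp_all
      qed (use not_dom_f_add_le[OF inf XY(1,2)] in blast)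
    qed (use assms in auto)
  qed
qed

lemma multiple_exchange_iff_mexch:
  assumes inf: "\<forall>X\<subseteq>N. f X \<noteq> \<infinity>"
  shows "multiple_exchange N f \<longleftrightarrow> mexch (dom_f N f) (\<lambda>S. real_of_ereal (f S))"
proof -
  have ex: "(\<exists>J\<subseteq>Y - X. f X + f Y \<le> f ((X - I) \<union> J) + f ((Y - J) \<union> I)) \<longleftrightarrow>
      (\<exists>J\<subseteq>Y - X. (X - I) \<union> J \<in> dom_f N f \<and> (Y - J) \<union> I \<in> dom_f N f \<and>
        real_of_ereal (f X) + real_of_ereal (f Y) \<le>
          real_of_ereal (f ((X - I) \<union> J)) + real_of_ereal (f ((Y - J) \<union> I)))"
    if XY: "X \<in> dom_f N f" "Y \<in> dom_f N f" "I \<subseteq> X - Y" for X Y I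
  proof (rule ex_cong1, rule conj_cong[OF refl])
    fix J assume "J \<subseteq> Y - X"
    then have "(X - I) \<union> J \<subseteq> N" "(Y - J) \<union> I \<subseteq> N" using XY by (auto simp: dom_f_def)
    then show "f X + f Y \<le> f ((X - I) \<union> J) + f ((Y - J) \<union> I) \<longleftrightarrow>
      (X - I) \<union> J \<in> dom_f N f \<and> (Y - J) \<union> I \<in> dom_f N f \<and>
        real_of_ereal (f X) + real_of_ereal (f Y) \<le>
          real_of_ereal (f ((X - I) \<union> J)) + real_of_ereal (f ((Y - J) \<union> I))"
      by (rule dom_f_add_le_iff[OF inf XY(1,2)])
  qed
  show ?thesis
  proof
    assume "multiple_exchange N f"
    then show "mexch (dom_f N f) (\<lambda>S. real_of_ereal (f S))"
      unfolding multiple_exchange_def mexch_def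
      by (intro ballI allI impI, subst ex[symmetric]) (auto simp: dom_f_def)
  next
    assume m: "mexch (dom_f N f) (\<lambda>S. real_of_ereal (f S))"
    show "multiple_exchange N f"
      unfolding multiple_exchange_def
    proof (intro allI impI)
      fix X Y I assume XY: "X \<subseteq> N" "Y \<subseteq> N" "I \<subseteq> X - Y"
      show "\<exists>J\<subseteq>Y - X. f X + f Y \<le> f ((X - I) \<union> J) + f ((Y - J) \<union> I)"
      proof (cases "X \<in> dom_f N f \<and> Y \<in> dom_f N f")
        case True
        then show ?thesis using m XY(3) unfolding mexch_def by (subst ex) auto
      qed (use not_dom_f_add_le[OF inf XY(1,2)] in blast)
    qed
  qed
qed

theorem theorem5:
  fixes N :: "'a set" and f :: "'a set \<Rightarrow> ereal"
  assumes "finite N"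
    and "\<forall>X\<subseteq>N. f X \<noteq> \<infinity>"
    and "dom_f N f \<noteq> {}"
  shows "M_nat_concave N f \<longleftrightarrow> multiple_exchange N f"
proof -
  have sub: "dom_f N f \<subseteq> Pow N" by (auto simp: dom_f_def)
  then have fin: "finite X" if "X \<in> dom_f N f" for X
    using that assms(1) by (auto intro: finite_subset)
  show ?thesis
    unfolding M_nat_concave_iff_mnat[OF assms] multiple_exchange_iff_mexch[OF assms(2)]
    using mnat_imp_mexch[OF _ assms(1) sub] mexch_imp_mnat[OF _ fin] by blast
qed

end
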